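(* Let $T_{\cos\theta}=\tfrac12(S+S^* )$ on the Hardy space $H^2$, where $(Sf)(z)=zf(z)$ is the unilateral shift. For $B\in\mathcal{B}(H^2)$ the following are equivalent. (i) $B^2=T_{\cos\theta}$. (ii) With respect to the orthonormal basis $(z^n)_{n=0}^\infty$ of $H^2$, the matrix representation of $B$ is $$\left[\frac{2}{\pi}\int_{-1}^1\phi(x)u_n(x)u_m(x)\rho(x)\,dx\right]_{m,n=0}^\infty,$$ where $\phi$ is a (complex-valued) measurable function on $[-1,1]$ satisfying $\phi(x)^2=x$.
   Context: $H^2$ is the Hardy space of the open unit disc and $\mathcal{B}(H^2)$ the bounded linear operators on it. $(u_n)_{n=0}^\infty$ are the Chebyshev polynomials of the second kind and $\rho(x)=\sqrt{1-x^2}$ on $[-1,1]$, so that $(\sqrt{2/\pi}\,u_n)_{n\ge0}$ is an orthonormal basis of $L^2([-1,1],\rho(x)\,dx)$. The matrix representation of $B$ is the matrix whose $(m,n)$ entry is $\langle Bz^n,z^m\rangle_{H^2}$. *)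

theory Defs
  imports "HOL-Complex_Analysis.Complex_Analysis"
begin

section \<open>The Hardy space of the unit disc\<close>

definition taylor_coeff :: "(complex \<Rightarrow> complex) \<Rightarrow> nat \<Rightarrow> complex" where
  "taylor_coeff f n = (deriv ^^ n) f 0 / fact n"

lemma power_series_on_disc:
  assumes "\<And>z. z \<in> ball 0 1 \<Longrightarrow> (\<lambda>n. a n * z ^ n) sums g z"
  shows "g holomorphic_on ball 0 1" and "taylor_coeff g = a"
proof -
  show "g holomorphic_on ball 0 1"
    by (rule power_series_holomorphic[of 0 1 a]) (use assms in simp)
  have "conv_radius a \<ge> 1"
  proof (rule conv_radius_geI_ex')
    fix r :: real assume "0 < r" "ereal r < 1"
    then show "summable (\<lambda>n. a n * of_real r ^ n)"
      using assms[of "of_real r"] by (auto simp: sums_iff one_ereal_def)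
  qed
  moreover have "eventually (\<lambda>z. eval_fps (Abs_fps a) z = g z) (nhds 0)"
    unfolding eventually_nhds
    by (rule exI[of _ "ball 0 1"]) (use assms in \<open>auto simp: eval_fps_def sums_iff\<close>)
  ultimately have "g has_fps_expansion Abs_fps a"
    by (auto simp: has_fps_expansion_def fps_conv_radius_def less_le_trans[of 0 1])
  from fps_nth_fps_expansion[OF this] show "taylor_coeff g = a"
    by (auto simp: taylor_coeff_def fun_eq_iff)
qed

lemma taylor_coeff_sums:
  assumes "f holomorphic_on ball 0 1" "z \<in> ball 0 1"
  shows "(\<lambda>n. taylor_coeff f n * z ^ n) sums f z"
  using holomorphic_power_series[OF assms] by (simp add: taylor_coeff_def)

text \<open>
  An element of \<open>H\<^sup>2\<close> is a function on the open unit disc; it is represented by its extension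
  by zero to the whole plane, so that equality in the type is equality on the disc.
\<close>

typedef hardy = "{f :: complex \<Rightarrow> complex. f holomorphic_on ball 0 1 \<and> (\<forall>z. z \<notin> ball 0 1 \<longrightarrow> f z = 0) \<and>
    summable (\<lambda>n. (cmod (taylor_coeff f n))\<^sup>2)}"
  morphisms hardy_fun Abs_hardy
proof (rule exI[of _ "\<lambda>_. 0"])
  have "taylor_coeff (\<lambda>_. 0) = (\<lambda>_. 0)"
    by (rule power_series_on_disc) simp
  then show "(\<lambda>_. 0) \<in> {f :: complex \<Rightarrow> complex. f holomorphic_on ball 0 1 \<and>
      (\<forall>z. z \<notin> ball 0 1 \<longrightarrow> f z = 0) \<and> summable (\<lambda>n. (cmod (taylor_coeff f n))\<^sup>2)}"
    by simp
qed

setup_lifting type_definition_hardy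

definition hardy_coeff :: "hardy \<Rightarrow> nat \<Rightarrow> complex" where
  "hardy_coeff f = taylor_coeff (hardy_fun f)"

lemma hardy_memI:
  assumes "\<And>z. z \<in> ball 0 1 \<Longrightarrow> (\<lambda>n. a n * z ^ n) sums g z"
    and "\<And>z. z \<notin> ball 0 1 \<Longrightarrow> g z = 0" and "summable (\<lambda>n. (cmod (a n))\<^sup>2)"
  shows "g holomorphic_on ball 0 1 \<and> (\<forall>z. z \<notin> ball 0 1 \<longrightarrow> g z = 0) \<and>
    summable (\<lambda>n. (cmod (taylor_coeff g n))\<^sup>2)"
  using power_series_on_disc[of a g] assms by auto

lemma hardy_coeff_sums: "z \<in> ball 0 1 \<Longrightarrow> (\<lambda>n. hardy_coeff f n * z ^ n) sums hardy_fun f z"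
  using hardy_fun[of f] by (auto simp: hardy_coeff_def intro!: taylor_coeff_sums)

lemma hardy_fun_outside: "z \<notin> ball 0 1 \<Longrightarrow> hardy_fun f z = 0"
  using hardy_fun[of f] by blast

lemma summable_hardy_coeff: "summable (\<lambda>n. (cmod (hardy_coeff f n))\<^sup>2)"
  using hardy_fun[of f] by (auto simp: hardy_coeff_def)

lemma hardy_coeff_eqI:
  "(\<And>z. z \<in> ball 0 1 \<Longrightarrow> (\<lambda>n. a n * z ^ n) sums hardy_fun f z) \<Longrightarrow> hardy_coeff f = a"
  unfolding hardy_coeff_def by (rule power_series_on_disc)

lemma hardy_eqI: "f = g" if "hardy_coeff f = hardy_coeff g"
proof -
  have "hardy_fun f z = hardy_fun g z" for z
    using hardy_coeff_sums[of z f] hardy_coeff_sums[of z g] hardy_fun_outside[of z] that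
    by (cases "z \<in> ball 0 1") (auto simp: sums_iff)
  then show ?thesis
    by (metis ext hardy_fun_inject)
qed

lemma summable_square_add:
  fixes a b :: "nat \<Rightarrow> complex"
  assumes "summable (\<lambda>n. (cmod (a n))\<^sup>2)" "summable (\<lambda>n. (cmod (b n))\<^sup>2)"
  shows "summable (\<lambda>n. (cmod (a n + b n))\<^sup>2)"
proof (rule summable_comparison_test')
  show "summable (\<lambda>n. 2 * (cmod (a n))\<^sup>2 + 2 * (cmod (b n))\<^sup>2)"
    by (intro summable_add summable_mult assms)
  fix n
  have "(cmod (a n + b n))\<^sup>2 \<le> (cmod (a n) + cmod (b n))\<^sup>2"
    by (simp add: norm_triangle_ineq power_mono)
  also have "\<dots> \<le> 2 * (cmod (a n))\<^sup>2 + 2 * (cmod (b n))\<^sup>2"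
    using sum_squares_bound[of "cmod (a n)" "cmod (b n)"] by (simp add: power2_sum)
  finally show "norm ((cmod (a n + b n))\<^sup>2) \<le> 2 * (cmod (a n))\<^sup>2 + 2 * (cmod (b n))\<^sup>2"
    by simp
qed

lemma summable_square_mult:
  fixes a b :: "nat \<Rightarrow> complex"
  assumes "summable (\<lambda>n. (cmod (a n))\<^sup>2)" "summable (\<lambda>n. (cmod (b n))\<^sup>2)"
  shows "summable (\<lambda>n. a n * cnj (b n))"
proof (rule summable_comparison_test')
  show "summable (\<lambda>n. (cmod (a n))\<^sup>2 + (cmod (b n))\<^sup>2)"
    by (intro summable_add assms)
  fix n
  have "cmod (a n) * cmod (b n) \<ge> 0" by simp
  then show "norm (a n * cnj (b n)) \<le> (cmod (a n))\<^sup>2 + (cmod (b n))\<^sup>2"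
    using sum_squares_bound[of "cmod (a n)" "cmod (b n)"]
    unfolding norm_mult complex_mod_cnj by linarith
qed

lift_definition hardy_scaleC :: "complex \<Rightarrow> hardy \<Rightarrow> hardy" is "\<lambda>c f z. c * f z"
proof -
  fix c :: complex and f :: "complex \<Rightarrow> complex"
  assume *: "f holomorphic_on ball 0 1 \<and> (\<forall>z. z \<notin> ball 0 1 \<longrightarrow> f z = 0) \<and>
    summable (\<lambda>n. (cmod (taylor_coeff f n))\<^sup>2)"
  show "(\<lambda>z. c * f z) holomorphic_on ball 0 1 \<and> (\<forall>z. z \<notin> ball 0 1 \<longrightarrow> c * f z = 0) \<and>
    summable (\<lambda>n. (cmod (taylor_coeff (\<lambda>z. c * f z) n))\<^sup>2)"
  proof (rule hardy_memI)
    show "(\<lambda>n. c * taylor_coeff f n * z ^ n) sums (c * f z)" if "z \<in> ball 0 1" for z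
      using sums_mult[OF taylor_coeff_sums[of f z], of c] * that by (simp add: mult.assoc)
    show "summable (\<lambda>n. (cmod (c * taylor_coeff f n))\<^sup>2)"
      using * by (auto simp: norm_mult power_mult_distrib intro!: summable_mult)
  qed (use * in auto)
qed

lemma hardy_coeff_scaleC [simp]: "hardy_coeff (hardy_scaleC c f) n = c * hardy_coeff f n"
  by (rule fun_cong[OF hardy_coeff_eqI])
     (use sums_mult[OF hardy_coeff_sums, of _ c f] in
       \<open>simp add: hardy_scaleC.rep_eq mult.assoc\<close>)

definition hardy_cinner :: "hardy \<Rightarrow> hardy \<Rightarrow> complex" where
  "hardy_cinner f g = (\<Sum>n. hardy_coeff f n * cnj (hardy_coeff g n))"

lemma hardy_cinner_sums:
  "(\<lambda>n. hardy_coeff f n * cnj (hardy_coeff g n)) sums hardy_cinner f g"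
  unfolding hardy_cinner_def
  by (intro summable_sums summable_square_mult summable_hardy_coeff)

text \<open>
  The library has real inner product spaces only. The real inner product is the real part of
  the complex one, so both induce the same norm, \<open>\<parallel>f\<parallel>\<^sup>2 = (\<Sum>n. |a\<^sub>n|\<^sup>2)\<close>.
\<close>

instantiation hardy :: real_inner
begin

lift_definition zero_hardy :: hardy is "\<lambda>_. 0"
  by (rule hardy_memI[of "\<lambda>_. 0"]) auto

lift_definition plus_hardy :: "hardy \<Rightarrow> hardy \<Rightarrow> hardy" is "\<lambda>f g z. f z + g z"
proof -
  fix f g :: "complex \<Rightarrow> complex"
  assume *: "f holomorphic_on ball 0 1 \<and> (\<forall>z. z \<notin> ball 0 1 \<longrightarrow> f z = 0) \<and>
    summable (\<lambda>n. (cmod (taylor_coeff f n))\<^sup>2)"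
    "g holomorphic_on ball 0 1 \<and> (\<forall>z. z \<notin> ball 0 1 \<longrightarrow> g z = 0) \<and>
    summable (\<lambda>n. (cmod (taylor_coeff g n))\<^sup>2)"
  show "(\<lambda>z. f z + g z) holomorphic_on ball 0 1 \<and> (\<forall>z. z \<notin> ball 0 1 \<longrightarrow> f z + g z = 0) \<and>
    summable (\<lambda>n. (cmod (taylor_coeff (\<lambda>z. f z + g z) n))\<^sup>2)"
  proof (rule hardy_memI)
    show "(\<lambda>n. (taylor_coeff f n + taylor_coeff g n) * z ^ n) sums (f z + g z)"
      if "z \<in> ball 0 1" for z
      using sums_add[OF taylor_coeff_sums[of f z] taylor_coeff_sums[of g z]] * that
      by (simp add: ring_distribs)
    show "summable (\<lambda>n. (cmod (taylor_coeff f n + taylor_coeff g n))\<^sup>2)"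
      using * by (intro summable_square_add) auto
  qed (use * in auto)
qed

definition uminus_hardy :: "hardy \<Rightarrow> hardy" where "- f = hardy_scaleC (-1) f"
definition minus_hardy :: "hardy \<Rightarrow> hardy \<Rightarrow> hardy" where "f - g = f + (- g :: hardy)"
definition scaleR_hardy :: "real \<Rightarrow> hardy \<Rightarrow> hardy" where
  "r *\<^sub>R f = hardy_scaleC (of_real r) f"
definition inner_hardy :: "hardy \<Rightarrow> hardy \<Rightarrow> real" where
  "inner f g = Re (hardy_cinner f g)"
definition norm_hardy :: "hardy \<Rightarrow> real" where "norm f = sqrt (inner f (f :: hardy))"
definition sgn_hardy :: "hardy \<Rightarrow> hardy" where "sgn f = inverse (norm f) *\<^sub>R (f :: hardy)"
definition dist_hardy :: "hardy \<Rightarrow> hardy \<Rightarrow> real" where "dist f g = norm (f - g :: hardy)"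
definition uniformity_hardy :: "(hardy \<times> hardy) filter" where
  "uniformity = (INF e\<in>{0 <..}. principal {(f, g :: hardy). dist f g < e})"
definition open_hardy :: "hardy set \<Rightarrow> bool" where
  "open U = (\<forall>f\<in>U. eventually (\<lambda>(f', g). f' = f \<longrightarrow> g \<in> U) (uniformity :: (hardy \<times> hardy) filter))"

lemma hardy_coeff_zero [simp]: "hardy_coeff 0 n = 0"
  by (rule fun_cong[OF hardy_coeff_eqI]) (simp add: zero_hardy.rep_eq)

lemma hardy_coeff_add [simp]: "hardy_coeff (f + g) n = hardy_coeff f n + hardy_coeff g n"
  by (rule fun_cong[OF hardy_coeff_eqI])
     (use sums_add[OF hardy_coeff_sums[of _ f] hardy_coeff_sums[of _ g]] in
       \<open>simp add: plus_hardy.rep_eq ring_distribs\<close>)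

lemma hardy_coeff_uminus [simp]: "hardy_coeff (- f) n = - hardy_coeff f n"
  by (simp add: uminus_hardy_def)

lemma hardy_coeff_diff [simp]: "hardy_coeff (f - g) n = hardy_coeff f n - hardy_coeff g n"
  by (simp add: minus_hardy_def)

lemma hardy_coeff_scaleR [simp]: "hardy_coeff (r *\<^sub>R f) n = of_real r * hardy_coeff f n"
  by (simp add: scaleR_hardy_def)

instance
proof
  fix f g h :: hardy and r s :: real
  note eq = hardy_eqI[OF ext]
  show "f + g + h = f + (g + h)" "f + g = g + f" "0 + f = f" "- f + f = 0" "f - g = f + - g"
    by (rule eq; simp)+
  show "r *\<^sub>R (f + g) = r *\<^sub>R f + r *\<^sub>R g" "(r + s) *\<^sub>R f = r *\<^sub>R f + s *\<^sub>R f"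
    "r *\<^sub>R s *\<^sub>R f = (r * s) *\<^sub>R f" "1 *\<^sub>R f = f"
    by (rule eq; simp add: ring_distribs)+
  show "dist f g = norm (f - g)" "sgn f = inverse (norm f) *\<^sub>R f" "norm f = sqrt (inner f f)"
    by (simp_all add: dist_hardy_def sgn_hardy_def norm_hardy_def)
  show "uniformity = (INF e\<in>{0 <..}. principal {(f, g :: hardy). dist f g < e})"
    by (rule uniformity_hardy_def)
  show "open U = (\<forall>f\<in>U. \<forall>\<^sub>F (f', g) in uniformity. f' = f \<longrightarrow> g \<in> U)" for U :: "hardy set"
    by (rule open_hardy_def)
  have sums: "(\<lambda>n. Re (hardy_coeff f n * cnj (hardy_coeff g n))) sums inner f g" for f g
    unfolding inner_hardy_def by (rule sums_Re[OF hardy_cinner_sums])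
  show "inner f g = inner g f"
    using sums[of f g] sums[of g f] by (simp add: sums_iff algebra_simps)
  show "inner (f + g) h = inner f h + inner g h"
    using sums_add[OF sums[of f h] sums[of g h]] sums[of "f + g" h]
    by (simp add: sums_iff algebra_simps)
  show "inner (r *\<^sub>R f) g = r * inner f g"
    using sums_mult[OF sums[of f g], of r] sums[of "r *\<^sub>R f" g]
    by (simp add: sums_iff algebra_simps)
  have sq: "(\<lambda>n. (cmod (hardy_coeff f n))\<^sup>2) sums inner f f"
    using sums[of f f] by (simp only: cmod_power2) (simp add: power2_eq_square)
  show "0 \<le> inner f f"
    using sums_le[OF _ sums_zero sq] by simp
  show "(inner f f = 0) = (f = 0)"
  proof
    assume "inner f f = 0"
    then have "hardy_coeff f n = 0" for n
      using sq suminf_eq_zero_iff[of "\<lambda>n. (cmod (hardy_coeff f n))\<^sup>2"] by (auto simp: sums_iff)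
    then show "f = 0" by (intro eq) simp
  next
    assume "f = 0"
    then show "inner f f = 0" using sq by (auto simp: sums_iff)
  qed
qed

end


section \<open>Operators on the Hardy space\<close>

definition hardy_operator :: "(hardy \<Rightarrow> hardy) \<Rightarrow> bool" where
  "hardy_operator B \<longleftrightarrow> bounded_linear B \<and> (\<forall>c f. B (hardy_scaleC c f) = hardy_scaleC c (B f))"

definition hardy_adjoint :: "(hardy \<Rightarrow> hardy) \<Rightarrow> hardy \<Rightarrow> hardy" where
  "hardy_adjoint A = (THE A'. \<forall>f g. hardy_cinner (A f) g = hardy_cinner f (A' g))"

lift_definition hardy_monom :: "nat \<Rightarrow> hardy" is "\<lambda>n z. if z \<in> ball 0 1 then z ^ n else 0"
proof -
  fix m :: nat
  let ?g = "\<lambda>z::complex. if z \<in> ball 0 1 then z ^ m else 0"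
  show "?g holomorphic_on ball 0 1 \<and> (\<forall>z. z \<notin> ball 0 1 \<longrightarrow> ?g z = 0) \<and>
    summable (\<lambda>n. (cmod (taylor_coeff ?g n))\<^sup>2)"
  proof (rule hardy_memI)
    show "(\<lambda>n. (if n = m then 1 else 0) * z ^ n) sums ?g z" if "z \<in> ball 0 1" for z
      using sums_single[of m "\<lambda>n. z ^ n"] that by (simp add: if_distrib[of "\<lambda>x. x * _"] cong: if_cong)
    show "summable (\<lambda>n. (cmod (if n = m then 1 else 0))\<^sup>2)"
      by (rule summable_finite[of "{m}"]) auto
  qed auto
qed

lift_definition hardy_shift :: "hardy \<Rightarrow> hardy" is "\<lambda>f z. z * f z"
proof -
  fix f :: "complex \<Rightarrow> complex"
  assume *: "f holomorphic_on ball 0 1 \<and> (\<forall>z. z \<notin> ball 0 1 \<longrightarrow> f z = 0) \<and>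
    summable (\<lambda>n. (cmod (taylor_coeff f n))\<^sup>2)"
  let ?a = "\<lambda>n. case n of 0 \<Rightarrow> 0 | Suc m \<Rightarrow> taylor_coeff f m"
  show "(\<lambda>z. z * f z) holomorphic_on ball 0 1 \<and> (\<forall>z. z \<notin> ball 0 1 \<longrightarrow> z * f z = 0) \<and>
    summable (\<lambda>n. (cmod (taylor_coeff (\<lambda>z. z * f z) n))\<^sup>2)"
  proof (rule hardy_memI)
    show "(\<lambda>n. ?a n * z ^ n) sums (z * f z)" if "z \<in> ball 0 1" for z
    proof -
      have "(\<lambda>n. ?a (Suc n) * z ^ Suc n) sums (z * f z)"
        using sums_mult[OF taylor_coeff_sums[of f z], of z] * that by (simp add: mult_ac)
      then show ?thesis
        by (subst (asm) sums_Suc_iff) simp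
    qed
    show "summable (\<lambda>n. (cmod (?a n))\<^sup>2)"
      by (subst summable_Suc_iff[symmetric]) (use * in simp)
  qed (use * in auto)
qed

lemma hardy_coeff_monom: "hardy_coeff (hardy_monom m) = (\<lambda>n. if n = m then 1 else 0)"
proof (rule hardy_coeff_eqI)
  fix z :: complex assume "z \<in> ball 0 1"
  then show "(\<lambda>n. (if n = m then 1 else 0) * z ^ n) sums hardy_fun (hardy_monom m) z"
    using sums_single[of m "\<lambda>n. z ^ n"]
    by (simp add: hardy_monom.rep_eq if_distrib[of "\<lambda>x. x * _"] cong: if_cong)
qed

lemma hardy_cinner_monom: "hardy_cinner (hardy_monom m) g = cnj (hardy_coeff g m)"
proof -
  have "(\<lambda>n. hardy_coeff (hardy_monom m) n * cnj (hardy_coeff g n)) sums cnj (hardy_coeff g m)"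
    using sums_single[of m "\<lambda>n. cnj (hardy_coeff g n)"]
    by (simp add: hardy_coeff_monom if_distrib[of "\<lambda>x. x * _"] cong: if_cong)
  then show ?thesis
    using hardy_cinner_sums sums_unique2 by blast
qed

lemma hardy_coeff_shift:
  "hardy_coeff (hardy_shift f) = (\<lambda>n. case n of 0 \<Rightarrow> 0 | Suc m \<Rightarrow> hardy_coeff f m)"
  (is "_ = ?a")
proof (rule hardy_coeff_eqI)
  fix z :: complex assume "z \<in> ball 0 1"
  then have "(\<lambda>n. ?a (Suc n) * z ^ Suc n) sums (z * hardy_fun f z)"
    using sums_mult[OF hardy_coeff_sums[of z f], of z] by (simp add: mult_ac)
  then show "(\<lambda>n. ?a n * z ^ n) sums hardy_fun (hardy_shift f) z"
    by (subst (asm) sums_Suc_iff) (simp add: hardy_shift.rep_eq)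
qed

lemma hardy_coeff_surj:
  assumes "summable (\<lambda>n. (cmod (a n))\<^sup>2)"
  obtains f where "hardy_coeff f = a"
proof -
  let ?g = "\<lambda>z. if z \<in> ball 0 1 then \<Sum>n. a n * z ^ n else 0"
  have sums: "(\<lambda>n. a n * z ^ n) sums ?g z" if z: "z \<in> ball 0 1" for z
  proof -
    have "summable (\<lambda>n. (cmod (cnj z ^ n))\<^sup>2)"
      using z summable_geometric[of "(cmod z)\<^sup>2"]
      by (simp add: norm_power power_mult[symmetric] mult.commute abs_square_less_1)
    from summable_square_mult[OF assms this] show ?thesis
      using z by (simp add: summable_sums)
  qed
  have "?g \<in> {f. f holomorphic_on ball 0 1 \<and> (\<forall>z. z \<notin> ball 0 1 \<longrightarrow> f z = 0) \<and>
    summable (\<lambda>n. (cmod (taylor_coeff f n))\<^sup>2)}"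
    unfolding mem_Collect_eq by (rule hardy_memI[OF sums]) (use assms in auto)
  then have "hardy_fun (Abs_hardy ?g) = ?g"
    by (rule Abs_hardy_inverse)
  then have "hardy_coeff (Abs_hardy ?g) = a"
    using sums by (intro hardy_coeff_eqI) simp
  then show thesis by (rule that)
qed

text \<open>The description defining \<open>S\<^sup>*\<close> is met by exactly one map.\<close>

lemma hardy_adjoint_eqI:
  assumes "\<And>f g. hardy_cinner (A f) g = hardy_cinner f (A' g)"
  shows "hardy_adjoint A = A'"
  unfolding hardy_adjoint_def
proof (rule the_equality)
  show "\<forall>f g. hardy_cinner (A f) g = hardy_cinner f (A' g)" using assms by blast
  fix A'' assume "\<forall>f g. hardy_cinner (A f) g = hardy_cinner f (A'' g)"
  then have "hardy_cinner (hardy_monom n) (A'' g) = hardy_cinner (hardy_monom n) (A' g)" for n g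
    using assms by metis
  then show "A'' = A'"
    by (intro ext hardy_eqI) (simp add: hardy_cinner_monom)
qed

lemma hardy_shift_adjoint:
  "hardy_cinner (hardy_shift f) g = hardy_cinner f (hardy_adjoint hardy_shift g)"
proof -
  have "\<exists>h. hardy_coeff h = (\<lambda>n. hardy_coeff g (Suc n))" for g
    using summable_hardy_coeff[of g] hardy_coeff_surj[of "\<lambda>n. hardy_coeff g (Suc n)"]
    by (metis summable_Suc_iff[of "\<lambda>n. (cmod (hardy_coeff g n))\<^sup>2"])
  then obtain A' where A': "\<And>g. hardy_coeff (A' g) = (\<lambda>n. hardy_coeff g (Suc n))" by metis
  have *: "hardy_cinner (hardy_shift f) g = hardy_cinner f (A' g)" for f g
  proof -
    have "(\<lambda>n. hardy_coeff (hardy_shift f) (Suc n) * cnj (hardy_coeff g (Suc n))) sums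
        hardy_cinner f (A' g)"
      using hardy_cinner_sums[of f "A' g"] by (simp add: hardy_coeff_shift A')
    then have "(\<lambda>n. hardy_coeff (hardy_shift f) n * cnj (hardy_coeff g n)) sums
        hardy_cinner f (A' g)"
      by (subst (asm) sums_Suc_iff) (simp add: hardy_coeff_shift)
    then show ?thesis using hardy_cinner_sums sums_unique2 by blast
  qed
  show ?thesis using hardy_adjoint_eqI[OF *] * by metis
qed

definition T_cos :: "hardy \<Rightarrow> hardy" where
  "T_cos f = (1/2) *\<^sub>R (hardy_shift f + hardy_adjoint hardy_shift f)"


section \<open>Chebyshev polynomials of the second kind\<close>

fun cheb_U :: "nat \<Rightarrow> real poly" where
  "cheb_U 0 = 1"
| "cheb_U (Suc 0) = [:0, 2:]"
| "cheb_U (Suc (Suc n)) = [:0, 2:] * cheb_U (Suc n) - cheb_U n"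

end

theory Submission
  imports Defs
begin


text \<open>Let \<mu> be the measure with density (2/pi) sqrt(1 - x^2) on [-1,1]
  (\<open>cheb_measure\<close>). The u_n form an orthonormal basis of L^2(\<mu>), so z^n -> u_n
  extends to a unitary from H^2 onto L^2(\<mu>). By the recurrence 2x u_n = u_{n+1} + u_{n-1} it
  carries \<open>T_cos\<close> to multiplication by x, and the matrix in the theorem is that of
  multiplication by \<phi>. The claim becomes: the bounded square roots of multiplication by x are
  the multiplications by measurable \<phi> with \<phi>^2 = x.

  A square root B commutes with B^2 = \<open>T_cos\<close>, and 1 is a cyclic vector of
  \<open>T_cos\<close>, since z^n is u_n(\<open>T_cos\<close>) applied to 1. Hence B is determined
  by the image F of B 1 in L^2(\<mu>), and its (m,n) entry is the \<mu>-integral of F u_n u_m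
  (\<open>sqrt_T_cos_coeff\<close>). Computing the coefficients of B(B 1) both through F and through
  \<open>T_cos\<close> shows that F^2 and x have the same Chebyshev coefficients, so they agree
  almost everywhere (\<open>sqrt_T_cos_symbol\<close>); a change on a null set makes this hold at
  every point (\<open>T_cos_symbol_modification\<close>). Conversely, \<phi>^2 = x forces |\<phi>|
  \<le> 1 on [-1,1], B acts as multiplication by \<phi>, and acting twice multiplies by x
  (\<open>symbol_imp_sqrt_T_cos\<close>).

  The analytic input is the transfer from H^2 to L^2(\<mu>) (\<open>hardy_cheb_expansion\<close>,
  resting on Riesz-Fischer in \<open>square_integrable_complete\<close>) and the fact that an
  integrable function with vanishing Chebyshev coefficients is 0 almost everywhere
  (\<open>AE_eq_0_if_cheb_coeffs_eq_0\<close>, resting on Stone-Weierstrass). The latter is wanted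
  in L^1, because F^2 is a priori only integrable. As the u_n are real, the bilinear integral of F G
  serves in place of an inner product.\<close>

section \<open>Square-integrable functions and completeness of L^2\<close>

definition square_integrable :: "'a measure \<Rightarrow> ('a \<Rightarrow> complex) \<Rightarrow> bool" where
  "square_integrable M F \<longleftrightarrow> F \<in> borel_measurable M \<and> integrable M (\<lambda>x. (cmod (F x))\<^sup>2)"

lemma square_integrable_measurable [measurable_dest]:
  "square_integrable M F \<Longrightarrow> F \<in> borel_measurable M"
  by (simp add: square_integrable_def)

lemma cmod_mult_le_squares: "cmod a * cmod b \<le> (cmod a)\<^sup>2 + (cmod b)\<^sup>2"
proof -
  have "0 \<le> cmod a * cmod b" by simp
  then show ?thesis using sum_squares_bound[of "cmod a" "cmod b"] by linarith
qed

lemma cmod_add_square_le: "(cmod (a + b))\<^sup>2 \<le> 2 * (cmod a)\<^sup>2 + 2 * (cmod b)\<^sup>2"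
proof -
  have "(cmod (a + b))\<^sup>2 \<le> (cmod a + cmod b)\<^sup>2"
    by (simp add: norm_triangle_ineq power_mono)
  also have "\<dots> \<le> 2 * (cmod a)\<^sup>2 + 2 * (cmod b)\<^sup>2"
    using sum_squares_bound[of "cmod a" "cmod b"] by (simp add: power2_sum)
  finally show ?thesis .
qed

lemma integrable_mult_square_integrable:
  assumes "square_integrable M F" "square_integrable M G"
  shows "integrable M (\<lambda>x. F x * G x)"
proof (rule Bochner_Integration.integrable_bound)
  show "integrable M (\<lambda>x. (cmod (F x))\<^sup>2 + (cmod (G x))\<^sup>2)"
    using assms by (auto simp: square_integrable_def)
  show "(\<lambda>x. F x * G x) \<in> borel_measurable M"
    using assms by (auto simp: square_integrable_def)
qed (simp add: norm_mult cmod_mult_le_squares)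

lemma square_integrable_add:
  assumes "square_integrable M F" "square_integrable M G"
  shows "square_integrable M (\<lambda>x. F x + G x)"
  unfolding square_integrable_def
proof
  show "(\<lambda>x. F x + G x) \<in> borel_measurable M"
    using assms by (auto simp: square_integrable_def)
  show "integrable M (\<lambda>x. (cmod (F x + G x))\<^sup>2)"
  proof (rule Bochner_Integration.integrable_bound)
    show "integrable M (\<lambda>x. 2 * (cmod (F x))\<^sup>2 + 2 * (cmod (G x))\<^sup>2)"
      using assms by (auto simp: square_integrable_def)
    show "(\<lambda>x. (cmod (F x + G x))\<^sup>2) \<in> borel_measurable M"
      using assms by (auto simp: square_integrable_def)
  qed (simp add: cmod_add_square_le)
qed

lemma square_integrable_bounded_mult:
  assumes [measurable]: "\<phi> \<in> borel_measurable M" and "AE x in M. cmod (\<phi> x) \<le> C"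
    and "square_integrable M F"
  shows "square_integrable M (\<lambda>x. \<phi> x * F x)"
  unfolding square_integrable_def
proof
  have [measurable]: "F \<in> borel_measurable M"
    using assms(3) by measurable
  show "(\<lambda>x. \<phi> x * F x) \<in> borel_measurable M"
    by measurable
  show "integrable M (\<lambda>x. (cmod (\<phi> x * F x))\<^sup>2)"
  proof (rule Bochner_Integration.integrable_bound)
    show "integrable M (\<lambda>x. C\<^sup>2 * (cmod (F x))\<^sup>2)"
      using assms(3) by (auto simp: square_integrable_def)
    show "(\<lambda>x. (cmod (\<phi> x * F x))\<^sup>2) \<in> borel_measurable M"
      by measurable
    show "AE x in M. norm ((cmod (\<phi> x * F x))\<^sup>2) \<le> norm (C\<^sup>2 * (cmod (F x))\<^sup>2)"
      using assms(2)
    proof eventually_elim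
      case (elim x)
      then have "(cmod (\<phi> x))\<^sup>2 \<le> C\<^sup>2"
        by (simp add: power_mono)
      then show ?case
        by (simp add: norm_mult power_mult_distrib mult_right_mono)
    qed
  qed
qed

lemma square_integrable_cmult:
  "square_integrable M F \<Longrightarrow> square_integrable M (\<lambda>x. c * F x)"
  by (rule square_integrable_bounded_mult[of "\<lambda>_. c" _ "cmod c"]) auto

lemma square_integrable_diff:
  assumes "square_integrable M F" "square_integrable M G"
  shows "square_integrable M (\<lambda>x. F x - G x)"
  using square_integrable_add[OF assms(1) square_integrable_cmult[OF assms(2), of "-1"]] by simp

lemma square_integrable_sum:
  "(\<And>i. i \<in> I \<Longrightarrow> square_integrable M (F i)) \<Longrightarrow> square_integrable M (\<lambda>x. \<Sum>i\<in>I. F i x)"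
proof (induction I rule: infinite_finite_induct)
  case (insert i I)
  then show ?case by (simp add: square_integrable_add)
qed (auto simp: square_integrable_def)

text \<open>Continuity of the pairing in its first argument. In place of Cauchy-Schwarz, the
  weighted inequality 2|u||v| \<le> |u|^2/t + t|v|^2 is integrated for one suitable t.\<close>

lemma tendsto_integral_mult_square_integrable:
  assumes "\<And>n. square_integrable M (f n)" "square_integrable M F" "square_integrable M G"
    and lim: "(\<lambda>n. LINT x|M. (cmod (f n x - F x))\<^sup>2) \<longlonglongrightarrow> 0"
  shows "(\<lambda>n. LINT x|M. f n x * G x) \<longlonglongrightarrow> (LINT x|M. F x * G x)"
proof (rule LIMSEQ_I)
  fix e :: real assume "e > 0"
  define b where "b = (LINT x|M. (cmod (G x))\<^sup>2)"
  define a where "a n = (LINT x|M. (cmod (f n x - F x))\<^sup>2)" for n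
  \<comment> \<open>This \<open>t\<close> gives t * b < e, and once a n < t * e also a n / t < e, so
    the mean of the two terms is below e. The 1 keeps the denominator positive when \<open>b\<close>
    is 0.\<close>
  define t where "t = e / (b + 1)"
  have "b \<ge> 0" unfolding b_def by simp
  with \<open>e > 0\<close> have "t > 0" by (simp add: t_def)
  have "t * b < e"
    using \<open>e > 0\<close> \<open>b \<ge> 0\<close> by (simp add: t_def field_simps)
  have bound: "cmod (LINT x|M. (f n x - F x) * G x) \<le> (a n / t + t * b) / 2" for n
  proof -
    have D: "square_integrable M (\<lambda>x. f n x - F x)"
      by (intro square_integrable_diff assms)
    have "cmod (LINT x|M. (f n x - F x) * G x) \<le> (LINT x|M. cmod ((f n x - F x) * G x))"
      by simp
    also have "\<dots> \<le> (LINT x|M. ((cmod (f n x - F x))\<^sup>2 / t + t * (cmod (G x))\<^sup>2) / 2)"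
    proof (rule integral_mono)
      show "integrable M (\<lambda>x. cmod ((f n x - F x) * G x))"
        by (intro integrable_norm integrable_mult_square_integrable D assms)
      show "integrable M (\<lambda>x. ((cmod (f n x - F x))\<^sup>2 / t + t * (cmod (G x))\<^sup>2) / 2)"
        using D assms(3) by (auto simp: square_integrable_def)
      fix x
      have "0 \<le> (cmod (f n x - F x) - t * cmod (G x))\<^sup>2 / t"
        using \<open>t > 0\<close> by simp
      also have "\<dots> = (cmod (f n x - F x))\<^sup>2 / t + t * (cmod (G x))\<^sup>2 - 2 * (cmod (f n x - F x) * cmod (G x))"
        using \<open>t > 0\<close> by (simp add: power2_eq_square field_simps)
      finally show "cmod ((f n x - F x) * G x) \<le> ((cmod (f n x - F x))\<^sup>2 / t + t * (cmod (G x))\<^sup>2) / 2"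
        by (simp add: norm_mult)
    qed
    also have "\<dots> = (a n / t + t * b) / 2"
      using D assms(3) by (simp add: a_def b_def square_integrable_def)
    finally show ?thesis .
  qed
  have "eventually (\<lambda>n. a n < t * e) sequentially"
    using order_tendstoD(2)[OF lim, of "t * e"] \<open>t > 0\<close> \<open>e > 0\<close> by (simp add: a_def)
  then obtain N where N: "\<And>n. n \<ge> N \<Longrightarrow> a n < t * e"
    by (auto simp: eventually_sequentially)
  have "norm ((LINT x|M. f n x * G x) - (LINT x|M. F x * G x)) < e" if "n \<ge> N" for n
  proof -
    have "(LINT x|M. f n x * G x) - (LINT x|M. F x * G x) = (LINT x|M. (f n x - F x) * G x)"
      unfolding left_diff_distrib
      by (intro Bochner_Integration.integral_diff[symmetric] integrable_mult_square_integrable assms)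
    moreover have "a n / t < e"
      using N[OF that] \<open>t > 0\<close> by (simp add: field_simps)
    ultimately show ?thesis
      using bound[of n] \<open>t * b < e\<close> by simp
  qed
  then show "\<exists>N. \<forall>n\<ge>N. norm ((LINT x|M. f n x * G x) - (LINT x|M. F x * G x)) < e"
    by blast
qed

text \<open>The weights \<open>4\<^sup>k\<close> on \<open>|f\<^sub>k\<^sub>+\<^sub>1 - f\<^sub>k|\<^sup>2\<close> give pointwise geometric decay without Cauchy--Schwarz, so
  \<open>M\<close> need not be finite.\<close>

lemma square_integrable_fast_Cauchy_AE_convergent:
  assumes "\<And>k. square_integrable M (f k)"
    and fast: "\<And>k. (LINT x|M. (cmod (f (Suc k) x - f k x))\<^sup>2) \<le> (1/8) ^ k"
  shows "AE x in M. convergent (\<lambda>k. f k x)"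
proof -
  define d where "d k x = f (Suc k) x - f k x" for k x
  have d: "square_integrable M (d k)" for k
    unfolding d_def by (intro square_integrable_diff assms)
  then have [measurable]: "d k \<in> borel_measurable M" for k
    by measurable
  define g where "g k x = ennreal (4 ^ k * (cmod (d k x))\<^sup>2)" for k x
  have [measurable]: "g k \<in> borel_measurable M" for k
    unfolding g_def by measurable
  have "(\<integral>\<^sup>+x. g k x \<partial>M) \<le> ennreal ((1/2) ^ k)" for k
  proof -
    have "(\<integral>\<^sup>+x. g k x \<partial>M) = ennreal (LINT x|M. 4 ^ k * (cmod (d k x))\<^sup>2)"
      unfolding g_def using d[of k]
      by (intro nn_integral_eq_integral) (auto simp: square_integrable_def)
    also have "\<dots> \<le> ennreal (4 ^ k * (1/8) ^ k)"
      using fast[of k] by (intro ennreal_leI) (simp add: d_def)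
    also have "(4 :: real) ^ k * (1/8) ^ k = (1/2) ^ k"
      by (simp flip: power_mult_distrib)
    finally show ?thesis .
  qed
  then have "(\<Sum>k. \<integral>\<^sup>+x. g k x \<partial>M) \<le> (\<Sum>k. ennreal ((1/2) ^ k))"
    by (intro suminf_le) auto
  also have "\<dots> < \<infinity>"
    by (subst suminf_ennreal2) (auto simp: summable_geometric)
  finally have "(\<integral>\<^sup>+x. (\<Sum>k. g k x) \<partial>M) \<noteq> \<infinity>"
    by (subst nn_integral_suminf) auto
  then have "AE x in M. (\<Sum>k. g k x) \<noteq> \<infinity>"
    by (intro nn_integral_PInf_AE) auto
  then show ?thesis
  proof eventually_elim
    case (elim x)
    then obtain C where C: "(\<Sum>k. g k x) = ennreal C" "C \<ge> 0"
      by (metis ennreal_cases infinity_ennreal_def)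
    \<comment> \<open>One term of the series is at most its sum \<open>C\<close>; the square root
      turns the weight 4^k into the decay (1/2)^k.\<close>
    have "cmod (d k x) \<le> sqrt C * (1/2) ^ k" if "k \<ge> 0" for k
    proof -
      have two_powers: "((2::real) ^ k)\<^sup>2 = 4 ^ k"
        by (simp add: power2_eq_square flip: power_mult_distrib)
      have "g k x \<le> ennreal C"
        unfolding C(1)[symmetric] using sum_le_suminf[of "\<lambda>k. g k x" "{k}"] by simp
      then have "(2 ^ k * cmod (d k x))\<^sup>2 \<le> C"
        using C(2) by (simp add: g_def power_mult_distrib two_powers)
      then have "2 ^ k * cmod (d k x) \<le> sqrt C"
        using real_le_rsqrt by blast
      then show ?thesis by (simp add: power_divide pos_le_divide_eq mult.commute)
    qed
    moreover have "summable (\<lambda>k. sqrt C * (1/2) ^ k)"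
      by (rule summable_mult[OF summable_geometric]) simp
    ultimately have "summable (\<lambda>k. d k x)"
      by (rule summable_comparison_test'[rotated])
    then have "(\<lambda>n. \<Sum>k<n. d k x) \<longlonglongrightarrow> (\<Sum>k. d k x)"
      by (rule summable_LIMSEQ)
    moreover have "(\<Sum>k<n. d k x) = f n x - f 0 x" for n
      unfolding d_def by (rule sum_lessThan_telescope)
    ultimately have "(\<lambda>n. (f n x - f 0 x) + f 0 x) \<longlonglongrightarrow> (\<Sum>k. d k x) + f 0 x"
      by (intro tendsto_add) auto
    then show ?case by (auto simp: convergent_def)
  qed
qed

text \<open>Riesz-Fischer: a fast Cauchy subsequence converges almost everywhere, and Fatou's lemma
  carries the Cauchy bound over to its pointwise limit.\<close>

lemma square_integrable_complete:
  assumes f: "\<And>n. square_integrable M (f n)"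
    and Cauchy: "\<And>e. e > 0 \<Longrightarrow> \<exists>N. \<forall>m\<ge>N. \<forall>n\<ge>N. (LINT x|M. (cmod (f m x - f n x))\<^sup>2) \<le> e"
  shows "\<exists>F. square_integrable M F \<and> (\<lambda>n. LINT x|M. (cmod (f n x - F x))\<^sup>2) \<longlonglongrightarrow> 0"
proof -
  have [measurable]: "f n \<in> borel_measurable M" for n
    using f[of n] by measurable
  have "\<exists>N. \<forall>k. \<forall>m\<ge>N k. \<forall>n\<ge>N k. (LINT x|M. (cmod (f m x - f n x))\<^sup>2) \<le> (1/8) ^ k"
    by (rule choice) (use Cauchy in auto)
  then obtain N where N: "\<And>k m n. m \<ge> N k \<Longrightarrow> n \<ge> N k \<Longrightarrow>
      (LINT x|M. (cmod (f m x - f n x))\<^sup>2) \<le> (1/8) ^ k"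
    by blast
  \<comment> \<open>Summing the thresholds makes \<open>s\<close> monotone and at least
    \<open>N k\<close>, which gives fast decay; adding \<open>k\<close> makes it tend to infinity,
    which Fatou needs below.\<close>
  define s where "s k = (\<Sum>i\<le>k. N i) + k" for k
  have s: "s k \<ge> N k" "s k \<ge> k" "s (Suc k) \<ge> s k" for k
    by (auto simp: s_def intro: member_le_sum trans_le_add1)
  have "AE x in M. convergent (\<lambda>k. f (s k) x)"
    using s(1) order_trans[OF s(1) s(3)]
    by (intro square_integrable_fast_Cauchy_AE_convergent f N)
  \<comment> \<open>On the null set where the subsequence diverges, \<open>lim\<close> takes some
    default value; \<open>F\<close> is still measurable.\<close>
  define F where "F x = lim (\<lambda>k. f (s k) x)" for x
  have [measurable]: "F \<in> borel_measurable M"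
    unfolding F_def by measurable
  have conv: "AE x in M. (\<lambda>k. f (s k) x) \<longlonglongrightarrow> F x"
    using \<open>AE x in M. convergent _\<close> by eventually_elim (simp add: F_def convergent_LIMSEQ_iff)
  \<comment> \<open>Stated with the nonnegative integral, since integrability of the limit is only
    deduced from this bound.\<close>
  have Fatou: "(\<integral>\<^sup>+x. ennreal ((cmod (f n x - F x))\<^sup>2) \<partial>M) \<le> ennreal e"
    if "\<forall>m\<ge>N. \<forall>n\<ge>N. (LINT x|M. (cmod (f m x - f n x))\<^sup>2) \<le> e" "n \<ge> N" "e \<ge> 0" for N n e
  proof -
    have "(\<integral>\<^sup>+x. ennreal ((cmod (f n x - F x))\<^sup>2) \<partial>M) =
        (\<integral>\<^sup>+x. liminf (\<lambda>k. ennreal ((cmod (f n x - f (s k) x))\<^sup>2)) \<partial>M)"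
    proof (rule nn_integral_cong_AE, use conv in eventually_elim)
      case (elim x)
      then have "(\<lambda>k. ennreal ((cmod (f n x - f (s k) x))\<^sup>2)) \<longlonglongrightarrow> ennreal ((cmod (f n x - F x))\<^sup>2)"
        by (intro tendsto_intros)
      then show ?case
        by (intro lim_imp_Liminf[symmetric]) auto
    qed
    also have "\<dots> \<le> liminf (\<lambda>k. \<integral>\<^sup>+x. ennreal ((cmod (f n x - f (s k) x))\<^sup>2) \<partial>M)"
      by (rule nn_integral_liminf) measurable
    also have "\<dots> \<le> ennreal e"
    proof (rule Liminf_le)
      show "eventually (\<lambda>k. (\<integral>\<^sup>+x. ennreal ((cmod (f n x - f (s k) x))\<^sup>2) \<partial>M) \<le> ennreal e) sequentially"
      proof (rule eventually_sequentiallyI[of N])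
        fix k assume "N \<le> k"
        then have "(LINT x|M. (cmod (f n x - f (s k) x))\<^sup>2) \<le> e"
          using that s(2)[of k] by auto
        then show "(\<integral>\<^sup>+x. ennreal ((cmod (f n x - f (s k) x))\<^sup>2) \<partial>M) \<le> ennreal e"
          using square_integrable_diff[OF f f, of n "s k"]
          by (subst nn_integral_eq_integral) (auto simp: square_integrable_def ennreal_leI)
      qed
    qed simp
    finally show ?thesis .
  qed
  have D: "square_integrable M (\<lambda>x. f n x - F x) \<and> (LINT x|M. (cmod (f n x - F x))\<^sup>2) \<le> e"
    if "\<forall>m\<ge>N. \<forall>n\<ge>N. (LINT x|M. (cmod (f m x - f n x))\<^sup>2) \<le> e" "n \<ge> N" "e \<ge> 0" for N n e
  proof
    have int: "integrable M (\<lambda>x. (cmod (f n x - F x))\<^sup>2)"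
      by (rule integrableI_bounded) (use Fatou[OF that] in \<open>auto intro: le_less_trans\<close>)
    then show "square_integrable M (\<lambda>x. f n x - F x)"
      by (simp add: square_integrable_def)
    show "(LINT x|M. (cmod (f n x - F x))\<^sup>2) \<le> e"
      using Fatou[OF that] that(3) int by (subst (asm) nn_integral_eq_integral) auto
  qed
  have "square_integrable M F"
  proof -
    obtain N where "\<forall>m\<ge>N. \<forall>n\<ge>N. (LINT x|M. (cmod (f m x - f n x))\<^sup>2) \<le> 1"
      using Cauchy[of 1] by auto
    from D[OF this order_refl] have "square_integrable M (\<lambda>x. f N x - F x)"
      by simp
    from square_integrable_diff[OF f[of N] this] show ?thesis by simp
  qed
  moreover have "(\<lambda>n. LINT x|M. (cmod (f n x - F x))\<^sup>2) \<longlonglongrightarrow> 0"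
  proof (rule LIMSEQ_I)
    fix r :: real assume "r > 0"
    then obtain N where N: "\<forall>m\<ge>N. \<forall>n\<ge>N. (LINT x|M. (cmod (f m x - f n x))\<^sup>2) \<le> r / 2"
      using Cauchy[of "r / 2"] by auto
    show "\<exists>N. \<forall>n\<ge>N. norm ((LINT x|M. (cmod (f n x - F x))\<^sup>2) - 0) < r"
    proof (intro exI allI impI)
      fix n assume "n \<ge> N"
      from D[OF N this] \<open>r > 0\<close> show "norm ((LINT x|M. (cmod (f n x - F x))\<^sup>2) - 0) < r"
        by simp
    qed
  qed
  ultimately show ?thesis by blast
qed



section \<open>The moment problem on a compact interval\<close>

lemma integrable_bounded_mult:
  fixes p g :: "'a \<Rightarrow> 'b::{banach, second_countable_topology, real_normed_algebra}"
  assumes [measurable]: "p \<in> borel_measurable M" and "AE x in M. norm (p x) \<le> C"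
    and g: "integrable M g"
  shows "integrable M (\<lambda>x. p x * g x)"
proof (rule Bochner_Integration.integrable_bound)
  have [measurable]: "g \<in> borel_measurable M" using g by measurable
  show "integrable M (\<lambda>x. C * norm (g x))"
    using g by (intro integrable_mult_right integrable_norm)
  show "(\<lambda>x. p x * g x) \<in> borel_measurable M" by measurable
  show "AE x in M. norm (p x * g x) \<le> norm (C * norm (g x))"
    using assms(2)
  proof eventually_elim
    case (elim x)
    then have "norm (p x * g x) \<le> C * norm (g x)"
      by (meson norm_mult_ineq order_trans mult_right_mono norm_ge_zero)
    then show ?case by simp
  qed
qed

text \<open>By linearity \<open>g\<close> annihilates polynomials; Stone-Weierstrass approximates
  \<open>p\<close> uniformly by them, with error at most d times the integral of |g|.\<close>

lemma integral_mult_continuous_eq_0: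
  fixes g :: "real \<Rightarrow> real"
  assumes g: "integrable (lebesgue_on {a..b}) g"
    and moments: "\<And>k. (LINT x|lebesgue_on {a..b}. x ^ k * g x) = 0"
    and p: "continuous_on {a..b} p"
  shows "(LINT x|lebesgue_on {a..b}. p x * g x) = 0"
proof -
  let ?M = "lebesgue_on {a..b}"
  have int: "integrable ?M (\<lambda>x. q x * g x)" if "continuous_on {a..b} q" for q
  proof -
    have "bounded (q ` {a..b})"
      by (rule compact_imp_bounded[OF compact_continuous_image[OF that]]) simp
    then obtain C where "\<And>x. x \<in> {a..b} \<Longrightarrow> \<bar>q x\<bar> \<le> C"
      unfolding bounded_iff by (metis image_eqI real_norm_def)
    then show ?thesis
      by (intro integrable_bounded_mult[where C = C] g continuous_imp_measurable_on_sets_lebesgue that)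
        auto
  qed
  have poly: "(LINT x|?M. q x * g x) = 0" if q: "real_polynomial_function q" for q
  proof -
    obtain c n where q: "q = (\<lambda>x. \<Sum>i\<le>n. c i * x ^ i)"
      using q by (auto simp: real_polynomial_function_iff_sum)
    have "(LINT x|?M. q x * g x) = (\<Sum>i\<le>n. LINT x|?M. (c i * x ^ i) * g x)"
      unfolding q sum_distrib_right
      by (rule Bochner_Integration.integral_sum) (intro int continuous_intros)
    also have "\<dots> = 0"
      by (simp add: mult.assoc moments)
    finally show ?thesis .
  qed
  define I where "I = (LINT x|?M. \<bar>g x\<bar>)"
  have "I \<ge> 0" by (simp add: I_def)
  have "\<bar>LINT x|?M. p x * g x\<bar> \<le> e" if "e > 0" for e
  proof -
    define d where "d = e / (I + 1)"
    have d: "d > 0" using that \<open>I \<ge> 0\<close> by (simp add: d_def)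
    obtain q where q: "real_polynomial_function q" "\<And>x. x \<in> {a..b} \<Longrightarrow> \<bar>p x - q x\<bar> < d"
      using Stone_Weierstrass_real_polynomial_function[OF compact_Icc p d] by blast
    have cq: "continuous_on {a..b} q"
      using q(1) by (simp add: continuous_on_polymonial_function real_polynomial_function_eq)
    have "(LINT x|?M. p x * g x) = (LINT x|?M. p x * g x) - (LINT x|?M. q x * g x)"
      by (simp add: poly q(1))
    also have "\<dots> = (LINT x|?M. (p x - q x) * g x)"
      unfolding left_diff_distrib
      by (intro Bochner_Integration.integral_diff[symmetric] int p cq)
    also have "\<bar>\<dots>\<bar> \<le> (LINT x|?M. \<bar>(p x - q x) * g x\<bar>)"
      using integral_norm_bound[of ?M "\<lambda>x. (p x - q x) * g x"] by simp
    also have "\<dots> \<le> (LINT x|?M. d * \<bar>g x\<bar>)"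
    proof (rule integral_mono)
      show "integrable ?M (\<lambda>x. \<bar>(p x - q x) * g x\<bar>)"
        by (intro integrable_abs int continuous_intros p cq)
      show "\<bar>(p x - q x) * g x\<bar> \<le> d * \<bar>g x\<bar>" if "x \<in> space ?M" for x
        using q(2)[of x] that by (auto simp: abs_mult intro!: mult_right_mono)
    qed (use g in simp)
    also have "\<dots> = d * I" by (simp add: I_def)
    also have "\<dots> \<le> e"
      using that \<open>I \<ge> 0\<close> by (simp add: d_def field_simps)
    finally show ?thesis .
  qed
  then have "\<bar>LINT x|?M. p x * g x\<bar> \<le> 0"
    by (meson field_le_epsilon add_0 dense_ge)
  then show ?thesis by simp
qed

text \<open>Testing \<open>g\<close> against continuous functions that approximate \<open>sgn g\<close> gives \<open>\<integral>|g| = 0\<close>.\<close>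

lemma AE_eq_0_if_moments_eq_0:
  fixes g :: "real \<Rightarrow> real"
  assumes g: "integrable (lebesgue_on {a..b}) g"
    and moments: "\<And>k. (LINT x|lebesgue_on {a..b}. x ^ k * g x) = 0"
  shows "AE x in lebesgue_on {a..b}. g x = 0"
proof -
  let ?M = "lebesgue_on {a..b}"
  have [measurable]: "g \<in> borel_measurable ?M" using g by measurable
  have "(\<lambda>x. sgn (g x)) \<in> borel_measurable ?M" by measurable
  \<comment> \<open>By definition \<open>measurable_on\<close> provides continuous functions
    converging to \<open>sgn (g x)\<close> off a negligible set.\<close>
  then have "(\<lambda>x. sgn (g x)) measurable_on {a..b}"
    by (subst measurable_on_iff_borel_measurable) auto
  then obtain N h where N: "negligible N" and h: "\<And>n. continuous_on UNIV (h n)"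
    and lim: "\<And>x. x \<notin> N \<Longrightarrow> (\<lambda>n. h n x) \<longlonglongrightarrow> (if x \<in> {a..b} then sgn (g x) else 0)"
    unfolding measurable_on_def by blast
  \<comment> \<open>Clipping to [-1,1] keeps continuity and the limit, whose values are -1, 0 or 1,
    and makes |g| a dominating function.\<close>
  define c where "c n x = max (-1) (min 1 (h n x))" for n x
  have c: "continuous_on {a..b} (c n)" for n
    unfolding c_def by (intro continuous_intros continuous_on_subset[OF h]) auto
  have [measurable]: "c n \<in> borel_measurable ?M" for n
    by (intro continuous_imp_measurable_on_sets_lebesgue c) auto
  have AEN: "AE x in ?M. x \<notin> N"
    using N by (auto simp: AE_restrict_space_iff negligible_iff_null_sets intro!: AE_not_in eventually_mono[OF AE_not_in])
  have "(\<lambda>n. LINT x|?M. c n x * g x) \<longlonglongrightarrow> (LINT x|?M. \<bar>g x\<bar>)"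
  proof (rule integral_dominated_convergence[where w = "\<lambda>x. \<bar>g x\<bar>"])
    show "AE x in ?M. (\<lambda>n. c n x * g x) \<longlonglongrightarrow> \<bar>g x\<bar>"
      using AEN AE_space
    proof eventually_elim
      case (elim x)
      then have "(\<lambda>n. h n x) \<longlonglongrightarrow> sgn (g x)"
        using lim[of x] by simp
      then have "(\<lambda>n. c n x * g x) \<longlonglongrightarrow> max (-1) (min 1 (sgn (g x))) * g x"
        unfolding c_def by (intro tendsto_intros)
      also have "max (-1) (min 1 (sgn (g x))) * g x = \<bar>g x\<bar>"
        by (auto simp: sgn_if)
      finally show ?case .
    qed
    show "AE x in ?M. norm (c n x * g x) \<le> \<bar>g x\<bar>" for n
      by (rule AE_I2) (auto simp: abs_mult c_def intro!: mult_left_le_one_le)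
  qed (use g in auto)
  moreover have "(LINT x|?M. c n x * g x) = 0" for n
    by (rule integral_mult_continuous_eq_0[OF g moments c])
  ultimately have "(LINT x|?M. \<bar>g x\<bar>) = 0"
    by (simp add: LIMSEQ_const_iff)
  then show ?thesis
    using integral_nonneg_eq_0_iff_AE[of ?M "\<lambda>x. \<bar>g x\<bar>"] g by auto
qed

section \<open>Chebyshev polynomials as an orthonormal basis\<close>

text \<open>The recurrence is the addition formula sin((n+3)t) + sin((n+1)t) = 2 cos t sin((n+2)t).
  Keeping the factor \<open>sin t\<close> on the left avoids dividing by its zeros.\<close>

lemma cheb_U_cos: "poly (cheb_U n) (cos t) * sin t = sin ((real n + 1) * t)"
proof (induction n rule: cheb_U.induct)
  case 2
  show ?case using sin_double[of t] by (simp add: mult_ac)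
next
  case (3 n)
  have "sin ((real n + 3) * t) + sin ((real n + 1) * t) = 2 * cos t * sin ((real n + 2) * t)"
    using sin_add[of "(real n + 2) * t" t] sin_diff[of "(real n + 2) * t" t]
    by (simp add: algebra_simps)
  then show ?case using 3 by (simp add: algebra_simps)
qed simp

text \<open>The convention u_{-1} = 0 is the case n = 0. The same shape reappears in
  \<open>hardy_coeff_T_cos\<close>, which is why \<open>T_cos\<close> becomes multiplication by
  x.\<close>

lemma cheb_U_mult_x:
  "2 * x * poly (cheb_U n) x = poly (cheb_U (Suc n)) x + (case n of 0 \<Rightarrow> 0 | Suc k \<Rightarrow> poly (cheb_U k) x)"
  by (cases n) (auto simp: algebra_simps)

text \<open>Under x = cos t the integrand becomes sin((n+1)t) sin((m+1)t), which has an elementary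
  antiderivative \<open>G\<close>; the integral over [-1,1] is G(pi) - G(0).\<close>

lemma has_integral_cheb_U_mult:
  "((\<lambda>x. poly (cheb_U n) x * poly (cheb_U m) x * sqrt (1 - x\<^sup>2)) has_integral
     (if n = m then pi / 2 else 0)) {-1..1}"
proof -
  \<comment> \<open>An antiderivative of cos(k t) for every k. The separate value at k = 0 produces
    the pi / 2 when n = m.\<close>
  define S where "S k t = (if k = 0 then t else sin (k * t) / k)" for k t :: real
  have S: "(S k has_real_derivative cos (k * t)) (at t)" for k t
    unfolding S_def by (cases "k = 0") (auto intro!: derivative_eq_intros)
  have contS: "continuous_on A (S k)" for A k
    using S by (meson DERIV_continuous_on has_field_derivative_at_within)
  define G where "G t = (S (real n - real m) t - S (real n + real m + 2) t) / 2" for t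
  have contG: "continuous_on A G" for A
    unfolding G_def by (intro continuous_intros contS) auto
  have G: "(G has_real_derivative sin ((real n + 1) * t) * sin ((real m + 1) * t)) (at t)" for t
  proof -
    have eq: "sin ((real n + 1) * t) * sin ((real m + 1) * t) =
        (cos ((real n - real m) * t) - cos ((real n + real m + 2) * t)) / 2"
      using cos_diff[of "(real n + 1) * t" "(real m + 1) * t"]
        cos_add[of "(real n + 1) * t" "(real m + 1) * t"]
      by (simp add: algebra_simps)
    show ?thesis
      unfolding G_def eq by (rule derivative_eq_intros S refl | simp)+
  qed
  \<comment> \<open>\<open>arccos\<close> is not differentiable at the endpoints, so the interior
    form of the fundamental theorem is used: continuity on [-1,1], derivative only inside.\<close>
  have "((\<lambda>x. poly (cheb_U n) x * poly (cheb_U m) x * sqrt (1 - x\<^sup>2)) has_integral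
     - G (arccos 1) - - G (arccos (-1))) {-1..1}"
  proof (rule fundamental_theorem_of_calculus_interior)
    show "continuous_on {-1..1} (\<lambda>x. - G (arccos x))"
      by (intro continuous_intros continuous_on_compose2[OF contG[of UNIV]]) auto
    fix x :: real assume "x \<in> {-1<..<1}"
    then have x: "-1 < x" "x < 1" by auto
    define t where "t = arccos x"
    have t: "cos t = x" "sin t = sqrt (1 - x\<^sup>2)"
      using x by (auto simp: t_def sin_arccos)
    have "1 - x\<^sup>2 > 0" using x by (simp add: abs_square_less_1)
    then have sin: "sin t > 0" by (simp add: t)
    have "((\<lambda>x. - G (arccos x)) has_real_derivative
        - (sin ((real n + 1) * t) * sin ((real m + 1) * t) * inverse (- sqrt (1 - x\<^sup>2)))) (at x)"
      unfolding t_def using DERIV_chain2[OF G DERIV_arccos[OF x]] by (rule DERIV_minus)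
    also have "- (sin ((real n + 1) * t) * sin ((real m + 1) * t) * inverse (- sqrt (1 - x\<^sup>2))) =
        poly (cheb_U n) x * poly (cheb_U m) x * sqrt (1 - x\<^sup>2)"
      unfolding cheb_U_cos[symmetric] t(2)[symmetric] using sin by (simp add: t(1))
    finally show "((\<lambda>x. - G (arccos x)) has_vector_derivative
        poly (cheb_U n) x * poly (cheb_U m) x * sqrt (1 - x\<^sup>2)) (at x)"
      by (simp add: has_real_derivative_iff_has_vector_derivative)
  qed simp
  moreover have "G 0 = 0" by (simp add: G_def S_def)
  moreover have "G pi = (if n = m then pi / 2 else 0)"
  proof -
    have "S (real n + real m + 2) pi = 0"
      using sin_npi[of "n + m + 2"] by (simp add: S_def add_ac)
    have "sin ((real n - real m) * pi) = 0"
      by (simp add: left_diff_distrib sin_diff)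
    then have "S (real n - real m) pi = (if n = m then pi else 0)"
      by (simp add: S_def)
    with \<open>S (real n + real m + 2) pi = 0\<close> show ?thesis
      by (simp add: G_def)
  qed
  ultimately show ?thesis by simp
qed

section \<open>The normalised Chebyshev weight as a measure\<close>

text \<open>With 2/pi inside the density, the u_n themselves are orthonormal and the matrix entries
  are plain integrals.\<close>

definition cheb_measure :: "real measure" where
  "cheb_measure = density (lebesgue_on {-1..1}) (\<lambda>x. ennreal (2 / pi * sqrt (1 - x\<^sup>2)))"

lemma space_cheb_measure [simp]: "space cheb_measure = {-1..1}"
  and sets_cheb_measure [measurable_cong, simp]: "sets cheb_measure = sets (lebesgue_on {-1..1})"
  by (auto simp: cheb_measure_def)

lemma borel_measurable_cheb_measure [simp]:
  "borel_measurable cheb_measure = borel_measurable (lebesgue_on {-1..1})"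
  by (rule measurable_cong_sets) auto

lemma cheb_weight_measurable [measurable]:
  "(\<lambda>x. sqrt (1 - x\<^sup>2)) \<in> borel_measurable (lebesgue_on {-1..1})"
  by (intro continuous_imp_measurable_on_sets_lebesgue continuous_intros) auto

lemma integrable_cheb_measure_iff:
  fixes f :: "real \<Rightarrow> complex"
  assumes [measurable]: "f \<in> borel_measurable (lebesgue_on {-1..1})"
  shows "integrable cheb_measure f \<longleftrightarrow>
    integrable (lebesgue_on {-1..1}) (\<lambda>x. f x * of_real (sqrt (1 - x\<^sup>2)))"
proof -
  have "integrable cheb_measure f \<longleftrightarrow>
    integrable (lebesgue_on {-1..1}) (\<lambda>x. (2 / pi * sqrt (1 - x\<^sup>2)) *\<^sub>R f x)"
    unfolding cheb_measure_def
    by (rule integrable_density) (auto simp: abs_square_le_1 abs_le_iff)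
  also have "(\<lambda>x. (2 / pi * sqrt (1 - x\<^sup>2)) *\<^sub>R f x) =
      (\<lambda>x. of_real (2 / pi) * (f x * of_real (sqrt (1 - x\<^sup>2))))"
    by (simp add: fun_eq_iff scaleR_conv_of_real)
  also have "integrable (lebesgue_on {-1..1}) \<dots> \<longleftrightarrow>
      integrable (lebesgue_on {-1..1}) (\<lambda>x. f x * of_real (sqrt (1 - x\<^sup>2)))" (is "integrable ?M (\<lambda>x. ?c * ?g x) = _")
  proof
    assume "integrable ?M (\<lambda>x. ?c * ?g x)"
    then have "integrable ?M (\<lambda>x. inverse ?c * (?c * ?g x))"
      by (rule integrable_mult_right)
    then show "integrable ?M ?g" by simp
  qed (rule integrable_mult_right)
  finally show ?thesis .
qed

lemma integral_cheb_measure: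
  fixes f :: "real \<Rightarrow> complex"
  assumes [measurable]: "f \<in> borel_measurable (lebesgue_on {-1..1})"
  shows "integral\<^sup>L cheb_measure f =
    of_real (2 / pi) * (LINT x|lebesgue_on {-1..1}. f x * of_real (sqrt (1 - x\<^sup>2)))"
proof -
  have "integral\<^sup>L cheb_measure f = (LINT x|lebesgue_on {-1..1}. (2 / pi * sqrt (1 - x\<^sup>2)) *\<^sub>R f x)"
    unfolding cheb_measure_def
    by (rule integral_density) (auto simp: abs_square_le_1 abs_le_iff)
  also have "(\<lambda>x. (2 / pi * sqrt (1 - x\<^sup>2)) *\<^sub>R f x) =
      (\<lambda>x. of_real (2 / pi) * (f x * of_real (sqrt (1 - x\<^sup>2))))"
    by (simp add: fun_eq_iff scaleR_conv_of_real)
  finally show ?thesis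
    by (simp del: of_real_divide)
qed

lemma AE_interior: "AE x in lebesgue_on {-1..1::real}. -1 < x \<and> x < 1"
proof -
  have "AE x in lebesgue. x \<notin> {-1, 1::real}"
    by (intro AE_not_in) (simp flip: negligible_iff_null_sets)
  then have "AE x in lebesgue. x \<in> {-1..1::real} \<longrightarrow> -1 < x \<and> x < 1"
    by eventually_elim (auto simp: less_le)
  then show ?thesis
    by (subst AE_restrict_space_iff) auto
qed

text \<open>On [-1,1] the density vanishes only at the two endpoints, so both measures have the same
  null sets.\<close>

lemma AE_cheb_measure_iff:
  "(AE x in cheb_measure. P x) \<longleftrightarrow> (AE x in lebesgue_on {-1..1}. P x)"
proof -
  have "(AE x in cheb_measure. P x) \<longleftrightarrow>
      (AE x in lebesgue_on {-1..1}. 0 < ennreal (2 / pi * sqrt (1 - x\<^sup>2)) \<longrightarrow> P x)"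
    unfolding cheb_measure_def by (rule AE_density) measurable
  also have "\<dots> \<longleftrightarrow> (AE x in lebesgue_on {-1..1}. P x)"
  proof (rule eventually_subst)
    show "AE x in lebesgue_on {-1..1}. (0 < ennreal (2 / pi * sqrt (1 - x\<^sup>2)) \<longrightarrow> P x) = P x"
      using AE_interior by eventually_elim (auto simp: abs_square_less_1)
  qed
  finally show ?thesis .
qed

lemma finite_measure_cheb_measure: "finite_measure cheb_measure"
proof
  have "emeasure cheb_measure (space cheb_measure) =
      (\<integral>\<^sup>+x. ennreal (2 / pi * sqrt (1 - x\<^sup>2)) \<partial>lebesgue_on {-1..1})"
    unfolding cheb_measure_def by (subst emeasure_density) (auto intro!: nn_integral_cong)
  also have "\<dots> \<le> (\<integral>\<^sup>+x. 1 \<partial>lebesgue_on {-1..1::real})"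
  proof (rule nn_integral_mono)
    fix x :: real
    have "sqrt (1 - x\<^sup>2) \<le> 1" by simp
    then have "2 / pi * sqrt (1 - x\<^sup>2) \<le> 2 / pi * 1"
      by (intro mult_left_mono) auto
    also have "\<dots> \<le> 1" using pi_ge_two by simp
    finally show "ennreal (2 / pi * sqrt (1 - x\<^sup>2)) \<le> 1"
      by (metis ennreal_1 ennreal_leI)
  qed
  also have "\<dots> < \<infinity>"
    by (simp add: emeasure_restrict_space)
  finally show "emeasure cheb_measure (space cheb_measure) \<noteq> \<infinity>" by simp
qed



section \<open>Orthonormality and completeness of the Chebyshev functions\<close>

definition cheb_fun :: "nat \<Rightarrow> real \<Rightarrow> complex" where
  "cheb_fun n x = of_real (poly (cheb_U n) x)"

lemma continuous_on_cheb_measure_bounded: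
  fixes p :: "real \<Rightarrow> complex"
  assumes "continuous_on {-1..1} p"
  obtains C where "p \<in> borel_measurable cheb_measure" "AE x in cheb_measure. cmod (p x) \<le> C"
proof -
  have "bounded (p ` {-1..1})"
    by (rule compact_imp_bounded[OF compact_continuous_image[OF assms]]) simp
  then obtain C where "\<And>x. x \<in> {-1..1} \<Longrightarrow> cmod (p x) \<le> C"
    unfolding bounded_iff by (metis image_eqI)
  moreover have "p \<in> borel_measurable cheb_measure"
    using assms by (simp add: continuous_imp_measurable_on_sets_lebesgue)
  ultimately show thesis
    by (intro that[of C] AE_I2) auto
qed

lemma square_integrable_bounded:
  assumes "\<phi> \<in> borel_measurable cheb_measure" "AE x in cheb_measure. cmod (\<phi> x) \<le> C"
  shows "square_integrable cheb_measure \<phi>"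
proof -
  interpret finite_measure cheb_measure
    by (rule finite_measure_cheb_measure)
  have "square_integrable cheb_measure (\<lambda>x. \<phi> x * 1)"
    by (rule square_integrable_bounded_mult[OF assms]) (simp add: square_integrable_def)
  then show ?thesis by simp
qed

lemma continuous_on_cheb_fun: "continuous_on A (cheb_fun n)"
  unfolding cheb_fun_def by (intro continuous_intros)

lemma square_integrable_cheb_fun: "square_integrable cheb_measure (cheb_fun n)"
  using continuous_on_cheb_measure_bounded[OF continuous_on_cheb_fun] square_integrable_bounded
  by metis

lemma square_integrable_mult_continuous:
  assumes "square_integrable cheb_measure F" "continuous_on {-1..1} p"
  shows "square_integrable cheb_measure (\<lambda>x. F x * p x)"
proof -
  obtain C where "p \<in> borel_measurable cheb_measure" "AE x in cheb_measure. cmod (p x) \<le> C"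
    using continuous_on_cheb_measure_bounded[OF assms(2)] .
  from square_integrable_bounded_mult[OF this assms(1)] show ?thesis
    by (simp add: mult.commute)
qed

lemma integrable_mult_continuous:
  assumes "integrable cheb_measure F" "continuous_on {-1..1} p"
  shows "integrable cheb_measure (\<lambda>x. F x * p x :: complex)"
proof -
  obtain C where "p \<in> borel_measurable cheb_measure" "AE x in cheb_measure. cmod (p x) \<le> C"
    using continuous_on_cheb_measure_bounded[OF assms(2)] .
  from integrable_bounded_mult[OF this assms(1)] show ?thesis
    by (simp add: mult.commute)
qed

lemma cheb_fun_mult_x:
  "of_real (2 * x) * cheb_fun n x = cheb_fun (Suc n) x + (case n of 0 \<Rightarrow> 0 | Suc k \<Rightarrow> cheb_fun k x)"
proof -
  have "of_real (2 * x) * cheb_fun n x = complex_of_real (2 * x * poly (cheb_U n) x)"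
    by (simp add: cheb_fun_def)
  also have "\<dots> = cheb_fun (Suc n) x + (case n of 0 \<Rightarrow> 0 | Suc k \<Rightarrow> cheb_fun k x)"
    unfolding cheb_U_mult_x by (simp add: cheb_fun_def split: nat.split)
  finally show ?thesis .
qed

lemma integral_cheb_fun_mult:
  "(LINT x|cheb_measure. cheb_fun n x * cheb_fun m x) = (if n = m then 1 else 0)"
proof -
  let ?M = "lebesgue_on {-1..1::real}"
  let ?f = "\<lambda>x. poly (cheb_U n) x * poly (cheb_U m) x * sqrt (1 - x\<^sup>2)"
  have meas: "(\<lambda>x. cheb_fun n x * cheb_fun m x) \<in> borel_measurable ?M"
    by (intro continuous_imp_measurable_on_sets_lebesgue continuous_intros continuous_on_cheb_fun) auto
  have int: "integrable ?M ?f"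
    by (intro continuous_imp_integrable_real continuous_intros)
  have "(LINT x|cheb_measure. cheb_fun n x * cheb_fun m x) =
      of_real (2 / pi) * (LINT x|?M. of_real (?f x))"
    unfolding integral_cheb_measure[OF meas] by (simp add: cheb_fun_def)
  also have "(LINT x|?M. of_real (?f x)) = complex_of_real (LINT x|?M. ?f x)"
    by (rule integral_complex_of_real)
  also have "(LINT x|?M. ?f x) = (if n = m then pi / 2 else 0)"
    using lebesgue_integral_eq_integral[OF int] has_integral_cheb_U_mult[of n m]
    by (simp add: integral_unique)
  finally show ?thesis by simp
qed

text \<open>Vanishing Chebyshev coefficients give vanishing moments, and the moment problem on
  [-1,1] then applies to \<open>g\<close> times the weight. Only integrability is assumed, so that
  the lemma covers products of two square-integrable functions.\<close>

lemma AE_eq_0_if_cheb_coeffs_eq_0: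
  assumes g: "integrable cheb_measure g"
    and coeffs: "\<And>m. (LINT x|cheb_measure. g x * cheb_fun m x) = 0"
  shows "AE x in cheb_measure. g x = 0"
proof -
  let ?M = "lebesgue_on {-1..1::real}"
  let ?w = "\<lambda>x::real. sqrt (1 - x\<^sup>2)"
  \<comment> \<open>The statement ranges over all \<open>m\<close> because multiplication by x moves
    the index both up and down. The moments are the case m = 0.\<close>
  have "(LINT x|cheb_measure. g x * (of_real x ^ k * cheb_fun m x)) = 0" for k m
  proof (induction k arbitrary: m)
    case 0
    then show ?case using coeffs by simp
  next
    case (Suc k)
    let ?I = "\<lambda>m. LINT x|cheb_measure. g x * (of_real x ^ k * cheb_fun m x)"
    have int: "integrable cheb_measure (\<lambda>x. g x * (of_real x ^ k * cheb_fun m x))" for m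
      by (intro integrable_mult_continuous g continuous_intros continuous_on_cheb_fun)
    have eq: "of_real x * cheb_fun m x = cheb_fun (Suc m) x / 2 + (case m of 0 \<Rightarrow> 0 | Suc k \<Rightarrow> cheb_fun k x / 2)" for x
      using cheb_fun_mult_x[of x m] by (simp add: field_simps split: nat.splits)
    have "g x * (of_real x ^ Suc k * cheb_fun m x) = g x * (of_real x ^ k * cheb_fun (Suc m) x) / 2 +
        (case m of 0 \<Rightarrow> 0 | Suc j \<Rightarrow> g x * (of_real x ^ k * cheb_fun j x) / 2)" for x
    proof -
      have "g x * (of_real x ^ Suc k * cheb_fun m x) = g x * of_real x ^ k * (of_real x * cheb_fun m x)"
        by simp
      then show ?thesis unfolding eq by (simp add: algebra_simps split: nat.split)
    qed
    moreover have "(LINT x|cheb_measure. g x * (of_real x ^ k * cheb_fun (Suc m) x) / 2 +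
        (case m of 0 \<Rightarrow> 0 | Suc j \<Rightarrow> g x * (of_real x ^ k * cheb_fun j x) / 2)) = 0"
      using Suc.IH int by (cases m) (simp_all add: Bochner_Integration.integral_add)
    ultimately show ?case by presburger
  qed
  from this[of _ 0] have moments: "(LINT x|cheb_measure. g x * of_real x ^ k) = 0" for k
    by (simp add: cheb_fun_def)
  define h where "h x = g x * of_real (?w x)" for x
  have [measurable]: "g \<in> borel_measurable ?M"
    using g borel_measurable_integrable by fastforce
  have h: "integrable ?M h"
    using g by (simp add: h_def[abs_def] integrable_cheb_measure_iff)
  have hk: "integrable ?M (\<lambda>x. of_real x ^ k * h x)" "(LINT x|?M. of_real x ^ k * h x) = 0" for k
  proof -
    have [measurable]: "(\<lambda>x. complex_of_real x ^ k) \<in> borel_measurable ?M"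
      by (intro continuous_imp_measurable_on_sets_lebesgue continuous_intros) auto
    have [measurable]: "(\<lambda>x. g x * of_real x ^ k) \<in> borel_measurable ?M"
      by measurable
    have "integrable cheb_measure (\<lambda>x. g x * of_real x ^ k)"
      by (intro integrable_mult_continuous g continuous_intros)
    then show "integrable ?M (\<lambda>x. of_real x ^ k * h x)"
      by (subst (asm) integrable_cheb_measure_iff) (simp_all add: h_def mult_ac)
    show "(LINT x|?M. of_real x ^ k * h x) = 0"
      using moments[of k] by (subst (asm) integral_cheb_measure) (simp_all add: h_def mult_ac)
  qed
  \<comment> \<open>The moment lemma is real, so real and imaginary parts are treated separately;
    the weight is then divided out in the open interval, where it is positive.\<close>
  have "(LINT x|?M. x ^ k * Re (h x)) = 0" "(LINT x|?M. x ^ k * Im (h x)) = 0" for k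
    using integral_Re[OF hk(1)[of k]] integral_Im[OF hk(1)[of k]] hk(2)[of k]
    by (simp_all flip: of_real_power)
  then have "AE x in ?M. Re (h x) = 0" "AE x in ?M. Im (h x) = 0"
    using h by (auto intro!: AE_eq_0_if_moments_eq_0)
  with AE_interior have "AE x in ?M. g x = 0"
  proof eventually_elim
    case (elim x)
    then have "h x = 0" by (simp add: complex_eq_iff)
    moreover have "?w x > 0" using elim by (simp add: abs_square_less_1 abs_less_iff)
    ultimately show ?case by (simp add: h_def)
  qed
  then show ?thesis by (simp add: AE_cheb_measure_iff)
qed

section \<open>Transfer from the Hardy space to the weighted L^2\<close>

text \<open>Finite Parseval identity. As the u_k are real, conjugation touches only the
  coefficients, and \<open>integral_cheb_fun_mult\<close> removes the mixed terms.\<close>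

lemma integral_cmod_square_cheb_sum:
  assumes "finite I"
  shows "(LINT x|cheb_measure. (cmod (\<Sum>k\<in>I. c k * cheb_fun k x))\<^sup>2) = (\<Sum>k\<in>I. (cmod (c k))\<^sup>2)"
proof -
  let ?s = "\<lambda>x. \<Sum>k\<in>I. c k * cheb_fun k x"
  have int: "integrable cheb_measure (\<lambda>x. c j * cnj (c k) * (cheb_fun j x * cheb_fun k x))" for j k
    by (intro integrable_mult_right integrable_mult_square_integrable square_integrable_cheb_fun)
  have "square_integrable cheb_measure ?s"
    by (intro square_integrable_sum square_integrable_cmult square_integrable_cheb_fun)
  have "complex_of_real (LINT x|cheb_measure. (cmod (?s x))\<^sup>2) =
      (LINT x|cheb_measure. of_real ((cmod (?s x))\<^sup>2))"
    by (rule integral_complex_of_real[symmetric])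
  also have "\<dots> = (LINT x|cheb_measure. (\<Sum>j\<in>I. \<Sum>k\<in>I. c j * cnj (c k) * (cheb_fun j x * cheb_fun k x)))"
    unfolding complex_norm_square cnj_sum sum_product
    by (simp add: cheb_fun_def mult_ac)
  also have "\<dots> = (\<Sum>j\<in>I. \<Sum>k\<in>I. c j * cnj (c k) * (if j = k then 1 else 0))"
    using int by (simp add: integral_cheb_fun_mult)
  also have "\<dots> = (\<Sum>j\<in>I. c j * cnj (c j))"
    using assms by (simp add: if_distrib cong: if_cong)
  also have "\<dots> = complex_of_real (\<Sum>j\<in>I. (cmod (c j))\<^sup>2)"
    by (simp add: complex_norm_square del: of_real_power)
  finally show ?thesis
    by (simp only: of_real_eq_iff)
qed

text \<open>The function \<open>F\<close> is the image of \<open>h\<close> under the unitary \<open>z\<^sup>n \<mapsto> u\<^sub>n\<close> onto \<open>L\<^sup>2(\<mu>)\<close>.\<close>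

lemma hardy_cheb_expansion:
  obtains F where "square_integrable cheb_measure F"
    "\<And>G. square_integrable cheb_measure G \<Longrightarrow>
      (\<lambda>k. hardy_coeff h k * (LINT x|cheb_measure. cheb_fun k x * G x)) sums
      (LINT x|cheb_measure. F x * G x)"
    "\<And>m. (LINT x|cheb_measure. F x * cheb_fun m x) = hardy_coeff h m"
proof -
  define c where "c = hardy_coeff h"
  define f where "f n x = (\<Sum>k<n. c k * cheb_fun k x)" for n x
  have f: "square_integrable cheb_measure (f n)" for n
    unfolding f_def by (intro square_integrable_sum square_integrable_cmult square_integrable_cheb_fun)
  \<comment> \<open>Parseval turns the squared distance of two partial sums into a block of the
    convergent series of |c_k|^2.\<close>
  have dist: "(LINT x|cheb_measure. (cmod (f m x - f n x))\<^sup>2) \<le> e"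
    if tail: "\<And>m n. m \<ge> N \<Longrightarrow> \<bar>\<Sum>k=m..<n. (cmod (c k))\<^sup>2\<bar> < e" and "m \<ge> N" "n \<ge> N" "n \<le> m" for N e m n
  proof -
    have "f m x - f n x = (\<Sum>k=n..<m. c k * cheb_fun k x)" for x
      unfolding f_def lessThan_atLeast0 using \<open>n \<le> m\<close> by (simp add: sum_diff_nat_ivl)
    then show ?thesis
      using less_imp_le[OF order_le_less_trans[OF abs_ge_self tail[OF \<open>n \<ge> N\<close>, of m]]]
      by (simp add: integral_cmod_square_cheb_sum)
  qed
  have "\<exists>N. \<forall>m\<ge>N. \<forall>n\<ge>N. (LINT x|cheb_measure. (cmod (f m x - f n x))\<^sup>2) \<le> e" if "e > 0" for e
  proof -
    from summable_hardy_coeff[of h, folded c_def, unfolded summable_Cauchy, rule_format, OF that]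
    obtain N where N: "\<And>m n. m \<ge> N \<Longrightarrow> \<bar>\<Sum>k=m..<n. (cmod (c k))\<^sup>2\<bar> < e"
      by auto
    have "(LINT x|cheb_measure. (cmod (f m x - f n x))\<^sup>2) \<le> e" if "m \<ge> N" "n \<ge> N" for m n
      using dist[OF N that] dist[OF N that(2,1)]
      by (cases "n \<le> m") (simp_all add: norm_minus_commute)
    then show ?thesis by blast
  qed
  from square_integrable_complete[OF f this] obtain F where
    F: "square_integrable cheb_measure F" "(\<lambda>n. LINT x|cheb_measure. (cmod (f n x - F x))\<^sup>2) \<longlonglongrightarrow> 0"
    by auto
  have sums: "(\<lambda>k. hardy_coeff h k * (LINT x|cheb_measure. cheb_fun k x * G x)) sums
      (LINT x|cheb_measure. F x * G x)" if G: "square_integrable cheb_measure G" for G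
  proof -
    have "(LINT x|cheb_measure. f n x * G x) = (\<Sum>k<n. c k * (LINT x|cheb_measure. cheb_fun k x * G x))" for n
      using integrable_mult_square_integrable[OF square_integrable_cheb_fun G]
      by (simp add: f_def sum_distrib_right mult.assoc)
    then show ?thesis
      using tendsto_integral_mult_square_integrable[OF f F(1) G F(2)] by (simp add: sums_def c_def)
  qed
  have "(LINT x|cheb_measure. F x * cheb_fun m x) = hardy_coeff h m" for m
  proof -
    have "(\<lambda>k. if k = m then hardy_coeff h k else 0) sums hardy_coeff h m"
      by (rule sums_single)
    moreover have "(\<lambda>k. if k = m then hardy_coeff h k else 0) sums (LINT x|cheb_measure. F x * cheb_fun m x)"
      using sums[OF square_integrable_cheb_fun, of m]
      by (simp add: integral_cheb_fun_mult if_distrib cong: if_cong)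
    ultimately show ?thesis by (metis sums_unique2)
  qed
  with F(1) sums show thesis by (rule that)
qed



section \<open>Square roots of the Toeplitz operator\<close>

lemma hardy_norm_sums: "(\<lambda>n. (cmod (hardy_coeff f n))\<^sup>2) sums (norm f)\<^sup>2"
proof -
  have "(\<lambda>n. Re (hardy_coeff f n * cnj (hardy_coeff f n))) sums Re (hardy_cinner f f)"
    by (rule sums_Re[OF hardy_cinner_sums])
  also have "(\<lambda>n. Re (hardy_coeff f n * cnj (hardy_coeff f n))) = (\<lambda>n. (cmod (hardy_coeff f n))\<^sup>2)"
    by (simp only: cmod_power2) (simp add: power2_eq_square)
  also have "Re (hardy_cinner f f) = (norm f)\<^sup>2"
    by (simp add: power2_norm_eq_inner inner_hardy_def)
  finally show ?thesis .
qed

lemma cmod_hardy_coeff_le: "cmod (hardy_coeff f n) \<le> norm f"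
proof -
  have "(cmod (hardy_coeff f n))\<^sup>2 \<le> (norm f)\<^sup>2"
    using sum_le_suminf[OF summable_hardy_coeff[of f], of "{n}"] hardy_norm_sums[of f]
    by (simp add: sums_iff)
  then show ?thesis
    by (rule power2_le_imp_le) simp
qed

lemma bounded_linear_hardy_coeff: "bounded_linear (\<lambda>f. hardy_coeff f n)"
  by (rule bounded_linear_intro[where K = 1])
    (auto simp: scaleR_conv_of_real cmod_hardy_coeff_le)

lemma hardy_coeff_sum: "hardy_coeff (\<Sum>k\<in>I. f k) n = (\<Sum>k\<in>I. hardy_coeff (f k) n)"
  by (induction I rule: infinite_finite_induct) auto

text \<open>The squared norm of the remainder after n terms is the tail of the series of
  |a_j|^2.\<close>

lemma hardy_expansion: "(\<lambda>k. hardy_scaleC (hardy_coeff f k) (hardy_monom k)) sums f"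
proof -
  let ?c = "\<lambda>k. (cmod (hardy_coeff f k))\<^sup>2"
  define s where "s n = (\<Sum>k<n. hardy_scaleC (hardy_coeff f k) (hardy_monom k))" for n
  have "hardy_coeff (f - s n) j = (if j < n then 0 else hardy_coeff f j)" for n j
    by (simp add: s_def hardy_coeff_sum hardy_coeff_monom if_distrib cong: if_cong)
  then have coeff: "(cmod (hardy_coeff (f - s n) j))\<^sup>2 = ?c j - (if j \<in> {..<n} then ?c j else 0)" for n j
    by simp
  have "(\<lambda>j. (cmod (hardy_coeff (f - s n) j))\<^sup>2) sums ((norm f)\<^sup>2 - (\<Sum>j<n. ?c j))" for n
    unfolding coeff by (intro sums_diff hardy_norm_sums sums_If_finite_set) simp
  then have "(norm (f - s n))\<^sup>2 = (norm f)\<^sup>2 - (\<Sum>j<n. ?c j)" for n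
    using hardy_norm_sums[of "f - s n"] sums_unique2 by blast
  moreover have "(\<lambda>n. (norm f)\<^sup>2 - (\<Sum>j<n. ?c j)) \<longlonglongrightarrow> (norm f)\<^sup>2 - (norm f)\<^sup>2"
    using hardy_norm_sums[of f] unfolding sums_def by (intro tendsto_intros)
  ultimately have "(\<lambda>n. sqrt ((norm (f - s n))\<^sup>2)) \<longlonglongrightarrow> sqrt 0"
    by (intro tendsto_real_sqrt) simp
  then have "(\<lambda>n. norm (s n - f)) \<longlonglongrightarrow> 0"
    by (simp add: norm_minus_commute)
  then have "s \<longlonglongrightarrow> f"
    by (simp add: tendsto_norm_zero_iff LIM_zero_iff)
  then show ?thesis
    by (simp add: sums_def s_def[abs_def])
qed

text \<open>The continuous functional taking f to the m-th coefficient of B f is applied term by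
  term to \<open>hardy_expansion\<close>: a bounded operator acts through its matrix.\<close>

lemma hardy_operator_coeff_sums:
  assumes "hardy_operator B"
  shows "(\<lambda>k. hardy_coeff f k * hardy_coeff (B (hardy_monom k)) m) sums hardy_coeff (B f) m"
proof -
  have "bounded_linear (\<lambda>f. hardy_coeff (B f) m)"
    using assms by (intro bounded_linear_compose[OF bounded_linear_hardy_coeff]) (simp add: hardy_operator_def)
  from bounded_linear.sums[OF this hardy_expansion[of f]] show ?thesis
    using assms by (simp add: hardy_operator_def)
qed

lemma hardy_shift_monom: "hardy_shift (hardy_monom n) = hardy_monom (Suc n)"
  by (rule hardy_eqI) (auto simp: hardy_coeff_shift hardy_coeff_monom split: nat.splits)

lemma hardy_coeff_adjoint_shift: "hardy_coeff (hardy_adjoint hardy_shift f) n = hardy_coeff f (Suc n)"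
  using hardy_shift_adjoint[of "hardy_monom n" f] by (simp add: hardy_shift_monom hardy_cinner_monom)

lemma hardy_coeff_T_cos:
  "hardy_coeff (T_cos f) m =
    (hardy_coeff f (Suc m) + (case m of 0 \<Rightarrow> 0 | Suc j \<Rightarrow> hardy_coeff f j)) / 2"
  by (simp add: T_cos_def hardy_coeff_adjoint_shift hardy_coeff_shift add.commute)

text \<open>Together with \<open>hardy_monom_Suc_Suc_T_cos\<close> this is the Chebyshev recurrence
  for z^n = u_n(\<open>T_cos\<close>) 1, the cyclicity of 1.\<close>

lemma hardy_monom_1_T_cos: "hardy_monom (Suc 0) = 2 *\<^sub>R T_cos (hardy_monom 0)"
  by (rule hardy_eqI) (auto simp: hardy_coeff_T_cos hardy_coeff_monom split: nat.splits)

lemma hardy_monom_Suc_Suc_T_cos: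
  "hardy_monom (Suc (Suc n)) = 2 *\<^sub>R T_cos (hardy_monom (Suc n)) - hardy_monom n"
  by (rule hardy_eqI) (auto simp: hardy_coeff_T_cos hardy_coeff_monom split: nat.splits)

lemma cheb_fun_0 [simp]: "cheb_fun 0 x = 1"
  by (simp add: cheb_fun_def)

lemma cheb_fun_1: "cheb_fun (Suc 0) x = 2 * of_real x"
  by (simp add: cheb_fun_def)

text \<open>The recurrence for u_{n+2} has a factor 2x, which is moved over to u_m. This mirrors the
  symmetry of \<open>T_cos\<close> and drives the induction on columns in
  \<open>sqrt_T_cos_coeff\<close>.\<close>

lemma cheb_fun_Suc_Suc_mult:
  "cheb_fun (Suc (Suc n)) x * cheb_fun m x = cheb_fun (Suc n) x * cheb_fun (Suc m) x +
    (case m of 0 \<Rightarrow> 0 | Suc j \<Rightarrow> cheb_fun (Suc n) x * cheb_fun j x) - cheb_fun n x * cheb_fun m x"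
proof -
  have rec: "cheb_fun (Suc (Suc n)) x = of_real (2 * x) * cheb_fun (Suc n) x - cheb_fun n x"
    using cheb_fun_mult_x[of x "Suc n"] by simp
  have "cheb_fun (Suc (Suc n)) x * cheb_fun m x =
      cheb_fun (Suc n) x * (of_real (2 * x) * cheb_fun m x) - cheb_fun n x * cheb_fun m x"
    unfolding rec by (simp add: algebra_simps)
  then show ?thesis
    unfolding cheb_fun_mult_x by (simp add: algebra_simps split: nat.split)
qed

lemma square_integrable_integrable:
  assumes "square_integrable cheb_measure F"
  shows "integrable cheb_measure F"
  using integrable_mult_square_integrable[OF assms square_integrable_cheb_fun[of 0]] by simp

section \<open>From a square root to its symbol\<close>

text \<open>Column 0 is given by \<open>F0\<close>. As B commutes with \<open>T_cos\<close>, each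
  further column of B follows from the two preceding ones by the recurrence that the integrals
  satisfy.\<close>

lemma sqrt_T_cos_coeff:
  assumes B: "hardy_operator B" "B \<circ> B = T_cos"
    and F: "square_integrable cheb_measure F"
    and F0: "\<And>m. (LINT x|cheb_measure. F x * cheb_fun m x) = hardy_coeff (B (hardy_monom 0)) m"
  shows "hardy_coeff (B (hardy_monom n)) m = (LINT x|cheb_measure. F x * (cheb_fun n x * cheb_fun m x))"
proof -
  interpret B: bounded_linear B
    using B(1) by (simp add: hardy_operator_def)
  \<comment> \<open>Both sides are B(B(B f)).\<close>
  have BT: "B (T_cos f) = T_cos (B f)" for f
    using B(2) by (metis comp_apply)
  have int [simp]: "integrable cheb_measure (\<lambda>x. F x * (cheb_fun n x * cheb_fun m x))" for n m
    by (intro integrable_mult_continuous square_integrable_integrable F continuous_intros continuous_on_cheb_fun)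
  have int1 [simp]: "integrable cheb_measure (\<lambda>x. F x * cheb_fun m x)" for m
    using int[of 0 m] by simp
  show ?thesis
  proof (induction n arbitrary: m rule: cheb_U.induct)
    case 1
    show ?case by (simp add: F0)
  next
    case 2
    have "F x * (cheb_fun (Suc 0) x * cheb_fun m x) =
        F x * cheb_fun (Suc m) x + (case m of 0 \<Rightarrow> 0 | Suc j \<Rightarrow> F x * cheb_fun j x)" for x
      using cheb_fun_mult_x[of x m] by (simp add: cheb_fun_1 algebra_simps split: nat.splits)
    then have "(LINT x|cheb_measure. F x * (cheb_fun (Suc 0) x * cheb_fun m x)) =
        (LINT x|cheb_measure. F x * cheb_fun (Suc m) x + (case m of 0 \<Rightarrow> 0 | Suc j \<Rightarrow> F x * cheb_fun j x))"
      by presburger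
    also have "\<dots> = hardy_coeff (B (hardy_monom (Suc 0))) m"
      unfolding hardy_monom_1_T_cos B.scaleR BT
      by (cases m) (simp_all add: hardy_coeff_T_cos F0)
    finally show ?case by simp
  next
    case (3 n)
    have "F x * (cheb_fun (Suc (Suc n)) x * cheb_fun m x) =
        F x * (cheb_fun (Suc n) x * cheb_fun (Suc m) x) +
        (case m of 0 \<Rightarrow> 0 | Suc j \<Rightarrow> F x * (cheb_fun (Suc n) x * cheb_fun j x)) -
        F x * (cheb_fun n x * cheb_fun m x)" for x
      unfolding cheb_fun_Suc_Suc_mult by (simp add: algebra_simps split: nat.split)
    then have "(LINT x|cheb_measure. F x * (cheb_fun (Suc (Suc n)) x * cheb_fun m x)) =
        (LINT x|cheb_measure. F x * (cheb_fun (Suc n) x * cheb_fun (Suc m) x) +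
        (case m of 0 \<Rightarrow> 0 | Suc j \<Rightarrow> F x * (cheb_fun (Suc n) x * cheb_fun j x)) -
        F x * (cheb_fun n x * cheb_fun m x))"
      by presburger
    also have "\<dots> = hardy_coeff (B (hardy_monom (Suc (Suc n)))) m"
      unfolding hardy_monom_Suc_Suc_T_cos B.scaleR B.diff BT
      using 3 by (cases m) (simp_all add: hardy_coeff_T_cos)
    finally show ?case by simp
  qed
qed

text \<open>\<open>F\<close> is the image of B 1. The m-th coefficient of B(B 1) is the integral of
  F^2 u_m by the matrix of B, and that of x u_m because B(B 1) = \<open>T_cos\<close> 1 =
  z/2.\<close>

lemma sqrt_T_cos_symbol:
  assumes B: "hardy_operator B" "B \<circ> B = T_cos"
  obtains F where "square_integrable cheb_measure F" "AE x in cheb_measure. (F x)\<^sup>2 = of_real x"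
    "\<And>n m. hardy_coeff (B (hardy_monom n)) m = (LINT x|cheb_measure. F x * (cheb_fun n x * cheb_fun m x))"
proof -
  obtain F where F: "square_integrable cheb_measure F"
    "\<And>G. square_integrable cheb_measure G \<Longrightarrow>
      (\<lambda>k. hardy_coeff (B (hardy_monom 0)) k * (LINT x|cheb_measure. cheb_fun k x * G x)) sums
      (LINT x|cheb_measure. F x * G x)"
    "\<And>m. (LINT x|cheb_measure. F x * cheb_fun m x) = hardy_coeff (B (hardy_monom 0)) m"
    using hardy_cheb_expansion[of "B (hardy_monom 0)"] by blast
  note matrix = sqrt_T_cos_coeff[OF B F(1,3)]
  \<comment> \<open>\<open>F\<close> is not known to be bounded, but u_m is; so F u_m is an
    admissible test function in the expansion of \<open>F\<close> itself.\<close>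
  have Fu: "square_integrable cheb_measure (\<lambda>x. F x * cheb_fun m x)" for m
    by (intro square_integrable_mult_continuous F continuous_on_cheb_fun)
  have FF: "(LINT x|cheb_measure. F x * (F x * cheb_fun m x)) = (LINT x|cheb_measure. of_real x * cheb_fun m x)" for m
  proof -
    have "(\<lambda>k. hardy_coeff (B (hardy_monom 0)) k * hardy_coeff (B (hardy_monom k)) m) sums
        (LINT x|cheb_measure. F x * (F x * cheb_fun m x))"
      using F(2)[OF Fu, of m] by (simp add: matrix mult_ac)
    then have "(LINT x|cheb_measure. F x * (F x * cheb_fun m x)) = hardy_coeff (B (B (hardy_monom 0))) m"
      using hardy_operator_coeff_sums[OF B(1), of "B (hardy_monom 0)" m] sums_unique2 by blast
    also have "B (B (hardy_monom 0)) = T_cos (hardy_monom 0)"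
      using B(2) by (metis comp_apply)
    also have "hardy_coeff (T_cos (hardy_monom 0)) m = (if Suc 0 = m then 1 else 0) / 2"
      by (auto simp: hardy_coeff_T_cos hardy_coeff_monom split: nat.splits)
    also have "\<dots> = (LINT x|cheb_measure. of_real x * cheb_fun m x)"
    proof -
      have "(LINT x|cheb_measure. cheb_fun (Suc 0) x * cheb_fun m x) =
          2 * (LINT x|cheb_measure. of_real x * cheb_fun m x)"
        by (simp add: cheb_fun_1 mult.assoc)
      then show ?thesis unfolding integral_cheb_fun_mult by simp
    qed
    finally show ?thesis .
  qed
  have intF: "integrable cheb_measure (\<lambda>x. F x * F x)"
    by (intro integrable_mult_square_integrable F)
  have intx: "integrable cheb_measure (\<lambda>x. complex_of_real x)"
    using square_integrable_integrable[OF square_integrable_cmult[OF square_integrable_cheb_fun[of "Suc 0"], of "1/2"]]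
    by (simp add: cheb_fun_1)
  have "AE x in cheb_measure. F x * F x - of_real x = 0"
  proof (rule AE_eq_0_if_cheb_coeffs_eq_0)
    show "integrable cheb_measure (\<lambda>x. F x * F x - of_real x)"
      using intF intx by simp
    show "(LINT x|cheb_measure. (F x * F x - of_real x) * cheb_fun m x) = 0" for m
      using FF[of m] integrable_mult_continuous[OF intF continuous_on_cheb_fun, of m]
        integrable_mult_continuous[OF intx continuous_on_cheb_fun, of m]
      by (simp add: left_diff_distrib mult.assoc)
  qed
  then have "AE x in cheb_measure. (F x)\<^sup>2 = of_real x"
    by (simp add: power2_eq_square)
  from F(1) this matrix show thesis by (rule that)
qed

text \<open>On the null set where the equation fails, \<open>F\<close> is replaced by an explicit
  square root, which changes no integral.\<close>

lemma T_cos_symbol_modification: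
  fixes F :: "real \<Rightarrow> complex"
  assumes F: "F \<in> borel_measurable (lebesgue_on {-1..1})" "AE x in lebesgue_on {-1..1}. (F x)\<^sup>2 = of_real x"
  obtains \<phi> where "\<phi> \<in> borel_measurable (lebesgue_on {-1..1})" "\<And>x. (\<phi> x)\<^sup>2 = of_real x"
    "AE x in lebesgue_on {-1..1}. \<phi> x = F x"
proof -
  note [measurable] = F(1)
  \<comment> \<open>A continuous square root of x: for each x at most one summand is nonzero, the
    second giving \<i> sqrt(-x) for negative x.\<close>
  define r where "r x = complex_of_real (sqrt (max 0 x)) + \<i> * complex_of_real (sqrt (max 0 (- x)))" for x
  have r: "(r x)\<^sup>2 = of_real x" for x
    by (cases "x \<ge> 0") (auto simp: r_def power_mult_distrib simp flip: of_real_power)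
  have [measurable]: "r \<in> borel_measurable (lebesgue_on {-1..1})"
    unfolding r_def by (intro continuous_imp_measurable_on_sets_lebesgue continuous_intros) auto
  have [measurable]: "complex_of_real \<in> borel_measurable (lebesgue_on {-1..1})"
    by (intro continuous_imp_measurable_on_sets_lebesgue continuous_intros) auto
  show thesis
  proof (rule that[of "\<lambda>x. if (F x)\<^sup>2 = of_real x then F x else r x"])
    show "(\<lambda>x. if (F x)\<^sup>2 = of_real x then F x else r x) \<in> borel_measurable (lebesgue_on {-1..1})"
      by measurable
    show "AE x in lebesgue_on {-1..1}. (if (F x)\<^sup>2 = of_real x then F x else r x) = F x"
      using F(2) by eventually_elim simp
  qed (auto simp: r)
qed

section \<open>From a symbol to a square root\<close>

text \<open>If \<open>F\<close> is the image of h, then \<phi> F is the image of B h, because both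
  have the same Chebyshev coefficients. Repeating this, B(B h) has the coefficients of \<phi>^2 F =
  x F, which are those of \<open>T_cos h\<close>.\<close>

lemma symbol_imp_sqrt_T_cos:
  assumes B: "hardy_operator B"
    and \<phi>: "\<phi> \<in> borel_measurable cheb_measure" "\<And>x. x \<in> {-1..1} \<Longrightarrow> (\<phi> x)\<^sup>2 = of_real x"
    and matrix: "\<And>n m. hardy_coeff (B (hardy_monom n)) m =
      (LINT x|cheb_measure. \<phi> x * cheb_fun n x * cheb_fun m x)"
  shows "B \<circ> B = T_cos"
proof
  fix h
  have "cmod (\<phi> x) \<le> 1" if "x \<in> {-1..1}" for x
  proof -
    have "(cmod (\<phi> x))\<^sup>2 = \<bar>x\<bar>"
      using \<phi>(2)[OF that] by (simp flip: norm_power)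
    also have "\<dots> \<le> 1\<^sup>2" using that by auto
    finally show ?thesis by (rule power2_le_imp_le) simp
  qed
  then have bdd: "AE x in cheb_measure. cmod (\<phi> x) \<le> 1"
    by (intro AE_I2) simp
  have \<phi>u: "square_integrable cheb_measure (\<lambda>x. \<phi> x * cheb_fun m x)" for m
    by (rule square_integrable_bounded_mult[OF \<phi>(1) bdd square_integrable_cheb_fun])
  \<comment> \<open>The premise says that \<open>G\<close> is the image of \<open>g\<close>; it is
    tested against \<phi> u_m. The general form serves both h with \<open>F\<close> and B h with
    \<open>K\<close>.\<close>
  have Bcoeff: "hardy_coeff (B g) m = (LINT x|cheb_measure. G x * (\<phi> x * cheb_fun m x))"
    if "\<And>H. square_integrable cheb_measure H \<Longrightarrow>
      (\<lambda>k. hardy_coeff g k * (LINT x|cheb_measure. cheb_fun k x * H x)) sums (LINT x|cheb_measure. G x * H x)"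
    for g G m
    using that[OF \<phi>u, of m] hardy_operator_coeff_sums[OF B, of g m]
    by (intro sums_unique2) (auto simp: matrix mult_ac)
  obtain F where F: "square_integrable cheb_measure F"
    "\<And>G. square_integrable cheb_measure G \<Longrightarrow>
      (\<lambda>k. hardy_coeff h k * (LINT x|cheb_measure. cheb_fun k x * G x)) sums (LINT x|cheb_measure. F x * G x)"
    "\<And>m. (LINT x|cheb_measure. F x * cheb_fun m x) = hardy_coeff h m"
    using hardy_cheb_expansion[of h] by blast
  obtain K where K: "square_integrable cheb_measure K"
    "\<And>G. square_integrable cheb_measure G \<Longrightarrow>
      (\<lambda>k. hardy_coeff (B h) k * (LINT x|cheb_measure. cheb_fun k x * G x)) sums (LINT x|cheb_measure. K x * G x)"
    "\<And>m. (LINT x|cheb_measure. K x * cheb_fun m x) = hardy_coeff (B h) m"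
    using hardy_cheb_expansion[of "B h"] by blast
  have \<phi>F: "square_integrable cheb_measure (\<lambda>x. \<phi> x * F x)"
    by (rule square_integrable_bounded_mult[OF \<phi>(1) bdd F(1)])
  have "AE x in cheb_measure. K x - \<phi> x * F x = 0"
  proof (rule AE_eq_0_if_cheb_coeffs_eq_0)
    show "integrable cheb_measure (\<lambda>x. K x - \<phi> x * F x)"
      by (intro square_integrable_integrable square_integrable_diff K \<phi>F)
    fix m
    have "(K x - \<phi> x * F x) * cheb_fun m x = K x * cheb_fun m x - F x * (\<phi> x * cheb_fun m x)" for x
      by (simp add: algebra_simps)
    then show "(LINT x|cheb_measure. (K x - \<phi> x * F x) * cheb_fun m x) = 0"
      using Bcoeff[OF F(2), of m] K(3)[of m]
        integrable_mult_square_integrable[OF K(1) square_integrable_cheb_fun, of m]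
        integrable_mult_square_integrable[OF F(1) \<phi>u, of m]
      by simp
  qed
  then have AE: "AE x in cheb_measure. K x * (\<phi> x * cheb_fun m x) = F x * (of_real x * cheb_fun m x)" for m
    using AE_space
  proof eventually_elim
    case (elim x)
    then have "K x * (\<phi> x * cheb_fun m x) = F x * ((\<phi> x)\<^sup>2 * cheb_fun m x)"
      by (simp add: power2_eq_square)
    also have "(\<phi> x)\<^sup>2 = of_real x" using elim \<phi>(2) by simp
    finally show ?case .
  qed
  have Fx: "integrable cheb_measure (\<lambda>x. F x * (of_real x * cheb_fun m x))" for m
    by (intro integrable_mult_continuous square_integrable_integrable F continuous_intros continuous_on_cheb_fun)
  have "hardy_coeff (B (B h)) m = hardy_coeff (T_cos h) m" for m
  proof -
    have "hardy_coeff (B (B h)) m = (LINT x|cheb_measure. K x * (\<phi> x * cheb_fun m x))"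
      by (rule Bcoeff[OF K(2)])
    also have "\<dots> = (LINT x|cheb_measure. F x * (of_real x * cheb_fun m x))"
      by (rule integral_cong_AE[OF _ _ AE])
        (use integrable_mult_square_integrable[OF K(1) \<phi>u] Fx in \<open>auto dest: borel_measurable_integrable\<close>)
    also have "\<dots> = (LINT x|cheb_measure. F x * cheb_fun (Suc m) x / 2 + (case m of 0 \<Rightarrow> 0 | Suc j \<Rightarrow> F x * cheb_fun j x / 2))"
    proof (rule Bochner_Integration.integral_cong[OF refl])
      fix x
      have "F x * (of_real x * cheb_fun m x) = F x / 2 * (of_real (2 * x) * cheb_fun m x)" by simp
      then show "F x * (of_real x * cheb_fun m x) =
          F x * cheb_fun (Suc m) x / 2 + (case m of 0 \<Rightarrow> 0 | Suc j \<Rightarrow> F x * cheb_fun j x / 2)"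
        unfolding cheb_fun_mult_x by (simp add: algebra_simps split: nat.split)
    qed
    also have "\<dots> = hardy_coeff (T_cos h) m"
      using integrable_mult_square_integrable[OF F(1) square_integrable_cheb_fun]
      by (cases m) (simp_all add: hardy_coeff_T_cos F(3) add_divide_distrib)
    finally show ?thesis .
  qed
  then show "(B \<circ> B) h = T_cos h"
    by (intro hardy_eqI ext) simp
qed

lemma hardy_cinner_monom_right: "hardy_cinner f (hardy_monom m) = hardy_coeff f m"
proof -
  have "(\<lambda>n. if n = m then hardy_coeff f n else 0) sums hardy_coeff f m"
    by (rule sums_single)
  then show ?thesis
    using hardy_cinner_sums[of f "hardy_monom m"] sums_unique2
    by (fastforce simp: hardy_coeff_monom if_distrib cong: if_cong)
qed

theorem theorem5p2:
  fixes B :: "hardy \<Rightarrow> hardy"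
  assumes "hardy_operator B"
  shows "B \<circ> B = T_cos \<longleftrightarrow>
    (\<exists>\<phi> :: real \<Rightarrow> complex.
      \<phi> \<in> borel_measurable (lebesgue_on {-1..1}) \<and>
      (\<forall>x\<in>{-1..1}. (\<phi> x)\<^sup>2 = of_real x) \<and>
      (\<forall>m n. hardy_cinner (B (hardy_monom n)) (hardy_monom m) =
        of_real (2 / pi) *
        (LINT x|lebesgue_on {-1..1}.
          \<phi> x * of_real (poly (cheb_U n) x) * of_real (poly (cheb_U m) x) *
          of_real (sqrt (1 - x\<^sup>2)))))"
proof -
  have cheb_meas [measurable]: "cheb_fun n \<in> borel_measurable (lebesgue_on {-1..1})" for n
    by (intro continuous_imp_measurable_on_sets_lebesgue continuous_on_cheb_fun) auto
  \<comment> \<open>The factor 2/pi and the weight are absorbed into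
    \<open>cheb_measure\<close>.\<close>
  have entry: "of_real (2 / pi) * (LINT x|lebesgue_on {-1..1}.
        \<phi> x * of_real (poly (cheb_U n) x) * of_real (poly (cheb_U m) x) * of_real (sqrt (1 - x\<^sup>2))) =
      (LINT x|cheb_measure. \<phi> x * cheb_fun n x * cheb_fun m x)"
    if [measurable]: "\<phi> \<in> borel_measurable (lebesgue_on {-1..1})" for \<phi> n m
    by (subst integral_cheb_measure) (measurable, simp add: cheb_fun_def)
  show ?thesis
  proof
    assume "B \<circ> B = T_cos"
    then obtain F where F: "square_integrable cheb_measure F" "AE x in cheb_measure. (F x)\<^sup>2 = of_real x"
      "\<And>n m. hardy_coeff (B (hardy_monom n)) m = (LINT x|cheb_measure. F x * (cheb_fun n x * cheb_fun m x))"
      using sqrt_T_cos_symbol[OF assms] by metis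
    have meas [measurable]: "F \<in> borel_measurable (lebesgue_on {-1..1})"
      using F(1) by (simp add: square_integrable_def)
    obtain \<phi> where \<phi> [measurable]: "\<phi> \<in> borel_measurable (lebesgue_on {-1..1})"
      and sq: "\<And>x. (\<phi> x)\<^sup>2 = of_real x" and eq: "AE x in cheb_measure. \<phi> x = F x"
      using T_cos_symbol_modification[OF meas] F(2) unfolding AE_cheb_measure_iff by metis
    have "(LINT x|cheb_measure. F x * (cheb_fun n x * cheb_fun m x)) =
        (LINT x|cheb_measure. \<phi> x * cheb_fun n x * cheb_fun m x)" for n m
      by (rule integral_cong_AE) (use eq in \<open>auto simp: mult.assoc\<close>)
    with \<phi> sq show "\<exists>\<phi>. \<phi> \<in> borel_measurable (lebesgue_on {-1..1}) \<and>
      (\<forall>x\<in>{-1..1}. (\<phi> x)\<^sup>2 = of_real x) \<and>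
      (\<forall>m n. hardy_cinner (B (hardy_monom n)) (hardy_monom m) =
        of_real (2 / pi) *
        (LINT x|lebesgue_on {-1..1}.
          \<phi> x * of_real (poly (cheb_U n) x) * of_real (poly (cheb_U m) x) *
          of_real (sqrt (1 - x\<^sup>2))))"
      by (intro exI[of _ \<phi>]) (simp only: entry F(3) hardy_cinner_monom_right, simp)
  next
    assume "\<exists>\<phi>. \<phi> \<in> borel_measurable (lebesgue_on {-1..1}) \<and>
      (\<forall>x\<in>{-1..1}. (\<phi> x)\<^sup>2 = of_real x) \<and>
      (\<forall>m n. hardy_cinner (B (hardy_monom n)) (hardy_monom m) =
        of_real (2 / pi) *
        (LINT x|lebesgue_on {-1..1}.
          \<phi> x * of_real (poly (cheb_U n) x) * of_real (poly (cheb_U m) x) *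
          of_real (sqrt (1 - x\<^sup>2))))"
    then obtain \<phi> where \<phi>: "\<phi> \<in> borel_measurable (lebesgue_on {-1..1})"
      "\<And>x. x \<in> {-1..1} \<Longrightarrow> (\<phi> x)\<^sup>2 = of_real x"
      "\<And>n m. hardy_coeff (B (hardy_monom n)) m = (LINT x|cheb_measure. \<phi> x * cheb_fun n x * cheb_fun m x)"
      unfolding hardy_cinner_monom_right using entry by auto
    then show "B \<circ> B = T_cos"
      by (intro symbol_imp_sqrt_T_cos[OF assms, of \<phi>]) auto
  qed
qed

end
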